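(* Let $\mathsf{V}$ be any (finitary or infinitary) variety of algebras, let $\mathsf{V}_{\mathsf{p}}$ be its associated category of presented algebras, and fix any $\mathsf{V}$-algebra $A$. Then the functors $\mathcal{C}\colon\mathsf{D}\to\mathsf{V}_{\mathsf{p}}^{\rm op}$ and $\mathcal{V}\colon\mathsf{V}_{\mathsf{p}}^{\rm op}\to\mathsf{D}$ defined in the context are adjoint, with $\mathcal{C}\dashv\mathcal{V}$.
   Context: Variety of algebras means an equationally definable class of algebras in the sense of Słominsky and Linton (operations of possibly infinite arity are allowed, free algebras exist), with its homomorphisms. For a cardinal $\nu$, $\mathcal{F}(\nu)$ is the free $\mathsf{V}$-algebra on generators $X_\beta$, $\beta<\nu$. Underlying-set functors are omitted. For $p\in\mathcal{F}(\nu)$ and $a=(a_\beta)_{\beta<\nu}\in A^\nu$, $\mathrm{ev}(p,a):=\widehat{a}(p)$, where $\widehat{a}\colon\mathcal{F}(\nu)\to A$ is the unique homomorphism with $X_\beta\mapsto a_\beta$. A homomorphism $h\colon\mathcal{F}(\mu)\to\mathcal{F}(\nu)$ induces the function $A^\nu\to A^\mu$, $a\mapsto(\mathrm{ev}(h(X_\beta),a))_{\beta<\mu}$; functions of this form are called definable. $\mathsf{V}_{\mathsf{p}}$: objects are presentations $(\mathcal{F}(\mu),\theta)$, with $\mu$ a cardinal and $\theta$ a congruence (equivalence relation compatible with all operations) on $\mathcal{F}(\mu)$; morphisms $(\mathcal{F}(\mu),\theta)\to(\mathcal{F}(\nu),\theta')$ are the $\mathsf{V}$-homomorphisms $\mathcal{F}(\mu)/\theta\to\mathcal{F}(\nu)/\theta'$.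 Every such homomorphism is induced by some homomorphism $\mathcal{F}(\mu)\to\mathcal{F}(\nu)$. $\mathsf{D}$: objects are subsets $S\subseteq A^\mu$ (with the embedding as part of the data), $\mu$ ranging over all cardinals; arrows from $S'\subseteq A^\nu$ to $S\subseteq A^\mu$ are the functions $S'\to S$ that are restrictions of definable functions $A^\nu\to A^\mu$. For $S\subseteq A^\mu$, $\mathbb{C}(S):=\{(p,q)\in\mathcal{F}(\mu)^2\mid\mathrm{ev}(p,a)=\mathrm{ev}(q,a)\ \forall a\in S\}$, a congruence on $\mathcal{F}(\mu)$; for $R\subseteq\mathcal{F}(\mu)^2$, $\mathbb{V}(R):=\{a\in A^\mu\mid\mathrm{ev}(p,a)=\mathrm{ev}(q,a)\ \forall (p,q)\in R\}$. $\mathcal{C}$ sends $S\subseteq A^\mu$ to $(\mathcal{F}(\mu),\mathbb{C}(S))$, and sends a $\mathsf{D}$-arrow from $S'\subseteq A^\nu$ to $S\subseteq A^\mu$, restriction of the definable function induced by $h\colon\mathcal{F}(\mu)\to\mathcal{F}(\nu)$, to (the opposite of) the homomorphism $\mathcal{F}(\mu)/\mathbb{C}(S)\to\mathcal{F}(\nu)/\mathbb{C}(S')$ induced by $h$. $\mathcal{V}$ sends $(\mathcal{F}(\mu),\theta)$ to $\mathbb{V}(\theta)\subseteq A^\mu$, and sends (the opposite of) a homomorphism $\mathcal{F}(\mu)/\theta\to\mathcal{F}(\nu)/\theta'$ induced by $h\colon\mathcal{F}(\mu)\to\mathcal{F}(\nu)$ to the restriction $\mathbb{V}(\theta')\to\mathbb{V}(\theta)$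 of the definable function induced by $h$. (Both are well defined.) *)

theory Defs
  imports Main "HOL-Library.FuncSet" "HOL-Library.Equipollence"
begin

section \<open>Varieties of algebras with operations of arbitrary arity\<close>

datatype ('f, 'i, 'v) trm = Var 'v | App 'f "'i \<Rightarrow> ('f, 'i, 'v) trm"

text \<open>
  A variety is presented by a set of operation symbols, an arbitrary (possibly infinite or empty)
  arity set for each symbol, and a set of equations in variables from \<open>'v\<close>.  The symbols form a
  set rather than a type because a signature may be empty.  No cardinality bound
  relates \<open>'f\<close>, \<open>'i\<close>, \<open>'v\<close> to each other or to the algebras considered.
\<close>

record ('f, 'i, 'v) eq_theory =
  symbols :: "'f set"
  arity :: "'f \<Rightarrow> 'i set"
  equations :: "(('f, 'i, 'v) trm \<times> ('f, 'i, 'v) trm) set"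

record ('f, 'i, 'a) algebra =
  carrier :: "'a set"
  oper :: "'f \<Rightarrow> ('i \<Rightarrow> 'a) \<Rightarrow> 'a"

definition is_algebra :: "('f, 'i, 'v) eq_theory \<Rightarrow> ('f, 'i, 'a) algebra \<Rightarrow> bool" where
  "is_algebra T A \<longleftrightarrow>
    (\<forall>f\<in>symbols T. \<forall>xs\<in>arity T f \<rightarrow>\<^sub>E carrier A. oper A f xs \<in> carrier A)"

text \<open>Homomorphisms are extensional functions, so that they are equal iff they agree on the carrier.\<close>

definition hom ::
  "('f, 'i, 'v) eq_theory \<Rightarrow> ('f, 'i, 'a) algebra \<Rightarrow> ('f, 'i, 'b) algebra \<Rightarrow> ('a \<Rightarrow> 'b) set" where
  "hom T A B = {h \<in> carrier A \<rightarrow>\<^sub>E carrier B.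
    \<forall>f\<in>symbols T. \<forall>xs\<in>arity T f \<rightarrow>\<^sub>E carrier A.
      h (oper A f xs) = oper B f (\<lambda>i\<in>arity T f. h (xs i))}"

definition congruence ::
  "('f, 'i, 'v) eq_theory \<Rightarrow> ('f, 'i, 'a) algebra \<Rightarrow> ('a \<times> 'a) set \<Rightarrow> bool" where
  "congruence T A \<theta> \<longleftrightarrow> equiv (carrier A) \<theta> \<and>
    (\<forall>f\<in>symbols T. \<forall>xs\<in>arity T f \<rightarrow>\<^sub>E carrier A. \<forall>ys\<in>arity T f \<rightarrow>\<^sub>E carrier A.
      (\<forall>i\<in>arity T f. (xs i, ys i) \<in> \<theta>) \<longrightarrow> (oper A f xs, oper A f ys) \<in> \<theta>)"

text \<open>Operations on the quotient are computed on arbitrarily chosen representatives.\<close>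

definition quot_alg ::
  "('f, 'i, 'v) eq_theory \<Rightarrow> ('f, 'i, 'a) algebra \<Rightarrow> ('a \<times> 'a) set \<Rightarrow> ('f, 'i, 'a set) algebra" where
  "quot_alg T A \<theta> = \<lparr>carrier = carrier A // \<theta>,
    oper = (\<lambda>f cs. \<theta> `` {oper A f (\<lambda>i\<in>arity T f. SOME x. x \<in> cs i)})\<rparr>"

inductive_set terms :: "('f, 'i, 'v) eq_theory \<Rightarrow> 'w set \<Rightarrow> ('f, 'i, 'w) trm set"
  for T :: "('f, 'i, 'v) eq_theory" and X :: "'w set" where
  Var: "x \<in> X \<Longrightarrow> Var x \<in> terms T X"
| App: "\<lbrakk>f \<in> symbols T; ts \<in> extensional (arity T f); \<And>i. i \<in> arity T f \<Longrightarrow> ts i \<in> terms T X\<rbrakk>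
    \<Longrightarrow> App f ts \<in> terms T X"

primrec eval ::
  "('f, 'i, 'v) eq_theory \<Rightarrow> ('f, 'i, 'a) algebra \<Rightarrow> ('w \<Rightarrow> 'a) \<Rightarrow> ('f, 'i, 'w) trm \<Rightarrow> 'a" where
  "eval T A \<rho> (Var x) = \<rho> x"
| "eval T A \<rho> (App f ts) = oper A f (restrict (\<lambda>i. eval T A \<rho> (ts i)) (arity T f))"

definition wf_theory :: "('f, 'i, 'v) eq_theory \<Rightarrow> bool" where
  "wf_theory T \<longleftrightarrow> equations T \<subseteq> terms T UNIV \<times> terms T UNIV"

definition in_variety :: "('f, 'i, 'v) eq_theory \<Rightarrow> ('f, 'i, 'a) algebra \<Rightarrow> bool" where
  "in_variety T A \<longleftrightarrow> is_algebra T A \<and>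
    (\<forall>(s, t)\<in>equations T. \<forall>\<rho>\<in>UNIV \<rightarrow> carrier A. eval T A \<rho> s = eval T A \<rho> t)"


section \<open>Free algebras\<close>

definition term_alg :: "('f, 'i, 'v) eq_theory \<Rightarrow> 'w set \<Rightarrow> ('f, 'i, ('f, 'i, 'w) trm) algebra" where
  "term_alg T X = \<lparr>carrier = terms T X, oper = App\<rparr>"

text \<open>
  The least congruence on the term algebra containing all substitution instances of the equations;
  evaluation in the term algebra is substitution.
\<close>

definition eq_cong ::
  "('f, 'i, 'v) eq_theory \<Rightarrow> 'w set \<Rightarrow> (('f, 'i, 'w) trm \<times> ('f, 'i, 'w) trm) set" where
  "eq_cong T X = \<Inter>{\<theta>. congruence T (term_alg T X) \<theta> \<and>
    (\<forall>(s, t)\<in>equations T. \<forall>\<sigma>\<in>UNIV \<rightarrow> terms T X.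
      (eval T (term_alg T X) \<sigma> s, eval T (term_alg T X) \<sigma> t) \<in> \<theta>)}"

text \<open>
  The elements of the well-order \<open>'k\<close> play the role of ordinals, \<open>{..<\<mu>}\<close> being the set of ordinals
  below \<open>\<mu>\<close>; cardinals are the initial ordinals.  "All cardinals" means all those in \<open>'k\<close>, an
  arbitrary well-ordered type that acts as the universe of ordinals.
\<close>

definition is_cardinal :: "'k::wellorder \<Rightarrow> bool" where
  "is_cardinal \<mu> \<longleftrightarrow> (\<forall>\<gamma><\<mu>. \<not> {..<\<gamma>} \<approx> {..<\<mu>})"

definition free_alg ::
  "('f, 'i, 'v) eq_theory \<Rightarrow> 'k::wellorder \<Rightarrow> ('f, 'i, ('f, 'i, 'k) trm set) algebra" where
  "free_alg T \<mu> = quot_alg T (term_alg T {..<\<mu>}) (eq_cong T {..<\<mu>})"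

definition gen :: "('f, 'i, 'v) eq_theory \<Rightarrow> 'k::wellorder \<Rightarrow> 'k \<Rightarrow> ('f, 'i, 'k) trm set" where
  "gen T \<mu> \<beta> = eq_cong T {..<\<mu>} `` {Var \<beta>}"

definition alg_power :: "('f, 'i, 'a) algebra \<Rightarrow> 'k::wellorder \<Rightarrow> ('k \<Rightarrow> 'a) set" where
  "alg_power A \<mu> = {..<\<mu>} \<rightarrow>\<^sub>E carrier A"

lemma is_algebra_term_alg: "is_algebra T (term_alg T X)"
  unfolding is_algebra_def term_alg_def by (auto intro!: terms.App simp: PiE_iff)

lemma eval_in_carrier:
  assumes "is_algebra T A" "t \<in> terms T X" "\<rho> \<in> X \<rightarrow> carrier A"
  shows "eval T A \<rho> t \<in> carrier A"
  using assms(2)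
proof induction
  case (Var x)
  then show ?case using assms(3) by auto
next
  case (App f ts)
  then have "(\<lambda>i\<in>arity T f. eval T A \<rho> (ts i)) \<in> arity T f \<rightarrow>\<^sub>E carrier A" by auto
  then show ?case using App.hyps(1) assms(1) unfolding is_algebra_def by simp
qed

lemma eval_subst:
  assumes "t \<in> terms T Y"
  shows "eval T A \<rho> (eval T (term_alg T X) \<sigma> t) = eval T A (\<lambda>y. eval T A \<rho> (\<sigma> y)) t"
  using assms
proof induction
  case (Var x)
  then show ?case by simp
next
  case (App f ts)
  then have "(\<lambda>i\<in>arity T f. eval T A \<rho> ((\<lambda>i\<in>arity T f. eval T (term_alg T X) \<sigma> (ts i)) i)) =
      (\<lambda>i\<in>arity T f. eval T A (\<lambda>y. eval T A \<rho> (\<sigma> y)) (ts i))"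
    by (auto simp: restrict_def)
  then show ?case by (simp add: term_alg_def)
qed

lemma congruence_eq_cong:
  assumes "wf_theory T"
  shows "congruence T (term_alg T X) (eq_cong T X)"
proof -
  define F where "F = {\<theta>. congruence T (term_alg T X) \<theta> \<and>
    (\<forall>(s, t)\<in>equations T. \<forall>\<sigma>\<in>UNIV \<rightarrow> terms T X.
      (eval T (term_alg T X) \<sigma> s, eval T (term_alg T X) \<sigma> t) \<in> \<theta>)}"
  have c: "carrier (term_alg T X) = terms T X" by (simp add: term_alg_def)
  have "congruence T (term_alg T X) (terms T X \<times> terms T X)"
    using is_algebra_term_alg[of T X] unfolding congruence_def is_algebra_def c
    by (auto simp: equiv_def refl_on_def sym_def trans_def)
  moreover have "eval T (term_alg T X) \<sigma> s \<in> terms T X"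
    if "s \<in> terms T UNIV" "\<sigma> \<in> UNIV \<rightarrow> terms T X" for s \<sigma>
    using eval_in_carrier[OF is_algebra_term_alg that(1), of \<sigma> X] that(2) c by auto
  ultimately have full: "terms T X \<times> terms T X \<in> F"
    using assms unfolding wf_theory_def F_def by auto
  have cong: "congruence T (term_alg T X) \<theta>" if "\<theta> \<in> F" for \<theta> using that unfolding F_def by blast
  have eq: "equiv (terms T X) \<theta>" if "\<theta> \<in> F" for \<theta>
    using cong[OF that] unfolding congruence_def c by blast
  have "equiv (terms T X) (\<Inter>F)"
  proof (rule equivI)
    show "\<Inter>F \<subseteq> terms T X \<times> terms T X" using full by blast
    show "refl_on (terms T X) (\<Inter>F)"
      using eq full unfolding refl_on_def equiv_def by blast
    show "sym (\<Inter>F)" using eq unfolding sym_def equiv_def by blast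
    show "trans (\<Inter>F)" using eq unfolding equiv_def trans_def by blast
  qed
  moreover have "(oper (term_alg T X) f xs, oper (term_alg T X) f ys) \<in> \<Inter>F"
    if "f \<in> symbols T" "xs \<in> arity T f \<rightarrow>\<^sub>E terms T X" "ys \<in> arity T f \<rightarrow>\<^sub>E terms T X"
      "\<forall>i\<in>arity T f. (xs i, ys i) \<in> \<Inter>F" for f xs ys
    using cong that unfolding congruence_def c by blast
  ultimately have "congruence T (term_alg T X) (\<Inter>F)" unfolding congruence_def c by blast
  then show ?thesis unfolding eq_cong_def F_def .
qed

lemma some_in_class:
  assumes "equiv B \<theta>" "c \<in> B // \<theta>"
  shows "(SOME x. x \<in> c) \<in> B" "\<theta> `` {SOME x. x \<in> c} = c"
proof -
  obtain y where "y \<in> B" "c = \<theta> `` {y}" using assms(2) by (auto elim: quotientE)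
  then have "y \<in> c" using assms(1) equiv_class_self by metis
  then have s: "(SOME x. x \<in> c) \<in> c" by (rule someI)
  then show "(SOME x. x \<in> c) \<in> B"
    using assms in_quotient_imp_subset by blast
  show "\<theta> `` {SOME x. x \<in> c} = c"
    using s \<open>c = \<theta> `` {y}\<close> assms(1) by (metis Image_singleton_iff equiv_class_eq)
qed

lemma oper_quot_alg:
  assumes "congruence T A \<theta>" "f \<in> symbols T" "xs \<in> arity T f \<rightarrow>\<^sub>E carrier A"
    and "\<And>i. i \<in> arity T f \<Longrightarrow> cs i = \<theta> `` {xs i}"
  shows "oper (quot_alg T A \<theta>) f cs = \<theta> `` {oper A f xs}"
proof -
  have eq: "equiv (carrier A) \<theta>" using assms(1) unfolding congruence_def by blast
  let ?ys = "\<lambda>i\<in>arity T f. SOME x. x \<in> cs i"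
  have *: "(SOME x. x \<in> cs i) \<in> carrier A \<and> \<theta> `` {SOME x. x \<in> cs i} = \<theta> `` {xs i}"
    if "i \<in> arity T f" for i
  proof -
    have "cs i \<in> carrier A // \<theta>" using assms(3,4) that by (auto intro: quotientI)
    from some_in_class[OF eq this] show ?thesis using assms(4)[OF that] by simp
  qed
  then have "?ys \<in> arity T f \<rightarrow>\<^sub>E carrier A" by auto
  moreover have "\<forall>i\<in>arity T f. (?ys i, xs i) \<in> \<theta>"
  proof
    fix i assume i: "i \<in> arity T f"
    then have "xs i \<in> carrier A" using assms(3) by auto
    then have "((SOME x. x \<in> cs i), xs i) \<in> \<theta>"
      using *[OF i] eq_equiv_class_iff[OF eq] by blast
    then show "(?ys i, xs i) \<in> \<theta>" using i by simp
  qed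
  ultimately have "(oper A f ?ys, oper A f xs) \<in> \<theta>"
    using assms(1-3) unfolding congruence_def by blast
  then show ?thesis unfolding quot_alg_def using equiv_class_eq[OF eq] by simp
qed

lemma is_algebra_quot_alg:
  assumes "is_algebra T A" "congruence T A \<theta>"
  shows "is_algebra T (quot_alg T A \<theta>)"
  unfolding is_algebra_def
proof (intro ballI)
  fix f cs assume f: "f \<in> symbols T" and cs: "cs \<in> arity T f \<rightarrow>\<^sub>E carrier (quot_alg T A \<theta>)"
  have eq: "equiv (carrier A) \<theta>" using assms(2) unfolding congruence_def by blast
  have "(\<lambda>i\<in>arity T f. SOME x. x \<in> cs i) \<in> arity T f \<rightarrow>\<^sub>E carrier A"
    using cs some_in_class(1)[OF eq] by (auto simp: quot_alg_def PiE_iff)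
  then show "oper (quot_alg T A \<theta>) f cs \<in> carrier (quot_alg T A \<theta>)"
    using assms(1) f unfolding is_algebra_def by (auto simp: quot_alg_def intro: quotientI)
qed

lemma eval_quot_alg:
  assumes "is_algebra T A" "congruence T A \<theta>" "t \<in> terms T X" "\<sigma> \<in> X \<rightarrow> carrier A"
    and "\<And>x. x \<in> X \<Longrightarrow> \<rho> x = \<theta> `` {\<sigma> x}"
  shows "eval T (quot_alg T A \<theta>) \<rho> t = \<theta> `` {eval T A \<sigma> t}"
  using assms(3)
proof induction
  case (Var x)
  then show ?case using assms(5) by simp
next
  case (App f ts)
  have "(\<lambda>i\<in>arity T f. eval T A \<sigma> (ts i)) \<in> arity T f \<rightarrow>\<^sub>E carrier A"
    using App.hyps eval_in_carrier[OF assms(1) _ assms(4)] by auto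
  then show ?case using App oper_quot_alg[OF assms(2) App.hyps(1)] by simp
qed

lemma in_variety_free_alg:
  assumes "wf_theory T"
  shows "in_variety T (free_alg T \<mu>)"
  unfolding in_variety_def
proof (intro conjI ballI, goal_cases)
  case 1
  show ?case unfolding free_alg_def
    by (rule is_algebra_quot_alg[OF is_algebra_term_alg congruence_eq_cong[OF assms]])
next
  case (2 e)
  let ?B = "term_alg T {..<\<mu>}" and ?\<theta> = "eq_cong T {..<\<mu>}"
  have cg: "congruence T ?B ?\<theta>" by (rule congruence_eq_cong[OF assms])
  then have eq: "equiv (carrier ?B) ?\<theta>" unfolding congruence_def by blast
  obtain s t where e: "e = (s, t)" by force
  then have st: "s \<in> terms T UNIV" "t \<in> terms T UNIV"
    using 2 assms unfolding wf_theory_def by auto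
  have "eval T (free_alg T \<mu>) \<rho> s = eval T (free_alg T \<mu>) \<rho> t"
    if \<rho>: "\<rho> \<in> UNIV \<rightarrow> carrier (free_alg T \<mu>)" for \<rho>
  proof -
    define \<sigma> where "\<sigma> v = (SOME x. x \<in> \<rho> v)" for v
    have "\<rho> v \<in> carrier ?B // ?\<theta>" for v using \<rho> by (auto simp: free_alg_def quot_alg_def)
    note some_in_class[OF eq this, folded \<sigma>_def]
    then have \<sigma>: "\<sigma> \<in> UNIV \<rightarrow> carrier ?B" "\<rho> v = ?\<theta> `` {\<sigma> v}" for v by auto
    have "\<sigma> \<in> UNIV \<rightarrow> terms T {..<\<mu>}" using \<sigma>(1) by (simp add: term_alg_def)
    then have "(eval T ?B \<sigma> s, eval T ?B \<sigma> t) \<in> ?\<theta>"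
      using 2 e unfolding eq_cong_def by blast
    then show ?thesis
      using eval_quot_alg[OF is_algebra_term_alg cg _ \<sigma>(1), of _ \<rho>] st \<sigma>(2) equiv_class_eq[OF eq]
      unfolding free_alg_def by metis
  qed
  then show ?case using e by simp
qed

lemma free_alg_universal:
  assumes wf: "wf_theory T" and A: "in_variety T A" and a: "a \<in> alg_power A \<nu>"
  shows "\<exists>!g. g \<in> hom T (free_alg T \<nu>) A \<and> (\<forall>\<beta><\<nu>. g (gen T \<nu> \<beta>) = a \<beta>)"
proof (rule ex_ex1I)
  let ?B = "term_alg T {..<\<nu>}" and ?\<theta> = "eq_cong T {..<\<nu>}"
  have cB: "carrier ?B = terms T {..<\<nu>}" by (simp add: term_alg_def)
  have cF: "carrier (free_alg T \<nu>) = terms T {..<\<nu>} // ?\<theta>"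
    by (simp add: free_alg_def quot_alg_def cB)
  have cg: "congruence T ?B ?\<theta>" by (rule congruence_eq_cong[OF wf])
  then have eq: "equiv (terms T {..<\<nu>}) ?\<theta>" unfolding congruence_def cB by blast
  have alg: "is_algebra T A" using A unfolding in_variety_def by blast
  have a': "a \<in> {..<\<nu>} \<rightarrow> carrier A" using a by (auto simp: alg_power_def)
  note ev = eval_in_carrier[OF alg _ a']
  define K where "K = {(s, t). s \<in> terms T {..<\<nu>} \<and> t \<in> terms T {..<\<nu>} \<and> eval T A a s = eval T A a t}"
  have "congruence T ?B K"
    unfolding congruence_def cB
  proof (intro conjI ballI impI)
    show "equiv (terms T {..<\<nu>}) K"
      by (rule equivI) (auto simp: K_def refl_on_def sym_def trans_def)
    fix f xs ys assume f: "f \<in> symbols T" "xs \<in> arity T f \<rightarrow>\<^sub>E terms T {..<\<nu>}"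
      "ys \<in> arity T f \<rightarrow>\<^sub>E terms T {..<\<nu>}" "\<forall>i\<in>arity T f. (xs i, ys i) \<in> K"
    have "(\<lambda>i\<in>arity T f. eval T A a (xs i)) = (\<lambda>i\<in>arity T f. eval T A a (ys i))"
      using f(4) by (auto simp: K_def restrict_def)
    then show "(oper ?B f xs, oper ?B f ys) \<in> K"
      using f by (auto simp: K_def term_alg_def PiE_iff intro!: terms.App)
  qed
  moreover have "(eval T ?B \<sigma> s, eval T ?B \<sigma> t) \<in> K"
    if "(s, t) \<in> equations T" "\<sigma> \<in> UNIV \<rightarrow> terms T {..<\<nu>}" for s t \<sigma>
  proof -
    have st: "s \<in> terms T UNIV" "t \<in> terms T UNIV" using that wf unfolding wf_theory_def by auto
    have "(\<lambda>y. eval T A a (\<sigma> y)) \<in> UNIV \<rightarrow> carrier A" using that(2) ev by auto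
    then have "eval T A (\<lambda>y. eval T A a (\<sigma> y)) s = eval T A (\<lambda>y. eval T A a (\<sigma> y)) t"
      using A that(1) unfolding in_variety_def by blast
    then show ?thesis
      using st that(2) eval_in_carrier[OF is_algebra_term_alg, of _ T UNIV \<sigma> "{..<\<nu>}"]
      by (auto simp: K_def eval_subst cB)
  qed
  ultimately have "?\<theta> \<subseteq> K" unfolding eq_cong_def by blast
  define g where "g = (\<lambda>c\<in>carrier (free_alg T \<nu>). eval T A a (SOME t. t \<in> c))"
  have g: "g (?\<theta> `` {t}) = eval T A a t" if "t \<in> terms T {..<\<nu>}" for t
  proof -
    have c: "?\<theta> `` {t} \<in> terms T {..<\<nu>} // ?\<theta>" using that by (rule quotientI)
    from some_in_class[OF eq c] have "(SOME s. s \<in> ?\<theta> `` {t}, t) \<in> ?\<theta>"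
      using eq_equiv_class_iff[OF eq _ that] by blast
    then show ?thesis using \<open>?\<theta> \<subseteq> K\<close> c unfolding g_def cF K_def by auto
  qed
  have "g \<in> hom T (free_alg T \<nu>) A"
    unfolding hom_def
  proof (intro CollectI conjI ballI)
    have "g c \<in> carrier A" if "c \<in> carrier (free_alg T \<nu>)" for c
      using that g ev unfolding cF by (auto elim!: quotientE)
    then show "g \<in> carrier (free_alg T \<nu>) \<rightarrow>\<^sub>E carrier A" by (auto simp: g_def)
    fix f cs assume f: "f \<in> symbols T" and cs: "cs \<in> arity T f \<rightarrow>\<^sub>E carrier (free_alg T \<nu>)"
    define ts where "ts = (\<lambda>i\<in>arity T f. SOME t. t \<in> cs i)"
    have ts: "ts i \<in> terms T {..<\<nu>}" "cs i = ?\<theta> `` {ts i}" if "i \<in> arity T f" for i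
    proof -
      have "cs i \<in> terms T {..<\<nu>} // ?\<theta>" using cs that by (auto simp: cF)
      from some_in_class[OF eq this] that
      show "ts i \<in> terms T {..<\<nu>}" "cs i = ?\<theta> `` {ts i}" by (simp_all add: ts_def)
    qed
    have ts': "ts \<in> arity T f \<rightarrow>\<^sub>E carrier ?B" using ts(1) by (auto simp: ts_def cB)
    have "oper (free_alg T \<nu>) f cs = ?\<theta> `` {App f ts}"
      using oper_quot_alg[OF cg f ts', of cs] ts(2) unfolding free_alg_def by (simp add: term_alg_def)
    moreover have "App f ts \<in> terms T {..<\<nu>}"
      using f ts(1) by (auto simp: ts_def intro!: terms.App)
    moreover have "(\<lambda>i\<in>arity T f. g (cs i)) = (\<lambda>i\<in>arity T f. eval T A a (ts i))"
      using ts g by (intro restrict_ext) simp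
    ultimately show "g (oper (free_alg T \<nu>) f cs) = oper A f (\<lambda>i\<in>arity T f. g (cs i))"
      using g by simp
  qed
  moreover have "\<forall>\<beta><\<nu>. g (gen T \<nu> \<beta>) = a \<beta>"
    unfolding gen_def by (simp add: g terms.Var)
  ultimately show "\<exists>g. g \<in> hom T (free_alg T \<nu>) A \<and> (\<forall>\<beta><\<nu>. g (gen T \<nu> \<beta>) = a \<beta>)" by blast
  fix h k
  assume h: "h \<in> hom T (free_alg T \<nu>) A \<and> (\<forall>\<beta><\<nu>. h (gen T \<nu> \<beta>) = a \<beta>)"
    and k: "k \<in> hom T (free_alg T \<nu>) A \<and> (\<forall>\<beta><\<nu>. k (gen T \<nu> \<beta>) = a \<beta>)"
  have val: "l (?\<theta> `` {t}) = eval T A a t"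
    if l: "l \<in> hom T (free_alg T \<nu>) A \<and> (\<forall>\<beta><\<nu>. l (gen T \<nu> \<beta>) = a \<beta>)"
      and "t \<in> terms T {..<\<nu>}" for l t
    using that(2)
  proof induction
    case (Var x)
    then show ?case using l by (simp add: gen_def)
  next
    case (App f ts)
    let ?cs = "\<lambda>i\<in>arity T f. ?\<theta> `` {ts i}"
    have "ts \<in> arity T f \<rightarrow>\<^sub>E carrier ?B" using App.hyps by (auto simp: cB PiE_iff)
    then have "oper (free_alg T \<nu>) f ?cs = ?\<theta> `` {App f ts}"
      using oper_quot_alg[OF cg App.hyps(1), of ts ?cs] unfolding free_alg_def
      by (simp add: term_alg_def)
    moreover have "?cs \<in> arity T f \<rightarrow>\<^sub>E carrier (free_alg T \<nu>)"
      using App.hyps by (auto simp: cF intro: quotientI)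
    moreover have "(\<lambda>i\<in>arity T f. l (?cs i)) = (\<lambda>i\<in>arity T f. eval T A a (ts i))"
      using App.IH by (auto simp: restrict_def)
    moreover have "l (oper (free_alg T \<nu>) f xs) = oper A f (\<lambda>i\<in>arity T f. l (xs i))"
      if "xs \<in> arity T f \<rightarrow>\<^sub>E carrier (free_alg T \<nu>)" for xs
      using l App.hyps(1) that unfolding hom_def by blast
    ultimately show ?case by (metis eval.simps(2))
  qed
  show "h = k"
  proof
    fix c
    show "h c = k c"
    proof (cases "c \<in> carrier (free_alg T \<nu>)")
      case True
      then show ?thesis using val[OF h] val[OF k] unfolding cF by (auto elim!: quotientE)
    next
      case False
      then show ?thesis using h k unfolding hom_def by (auto simp: PiE_iff extensional_def)
    qed
  qed
qed

text \<open>The description in \<open>ev\<close> is proper by \<open>free_alg_universal\<close>.\<close>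

definition ev ::
  "('f, 'i, 'v) eq_theory \<Rightarrow> ('f, 'i, 'a) algebra \<Rightarrow> 'k::wellorder
    \<Rightarrow> ('f, 'i, 'k) trm set \<Rightarrow> ('k \<Rightarrow> 'a) \<Rightarrow> 'a" where
  "ev T A \<nu> p a = (THE g. g \<in> hom T (free_alg T \<nu>) A \<and> (\<forall>\<beta><\<nu>. g (gen T \<nu> \<beta>) = a \<beta>)) p"

text \<open>The definable function \<open>A\<^sup>\<nu> \<rightarrow> A\<^sup>\<mu>\<close> induced by \<open>h : F \<mu> \<rightarrow> F \<nu>\<close>.\<close>

definition definable_fun ::
  "('f, 'i, 'v) eq_theory \<Rightarrow> ('f, 'i, 'a) algebra \<Rightarrow> 'k::wellorder \<Rightarrow> 'k
    \<Rightarrow> (('f, 'i, 'k) trm set \<Rightarrow> ('f, 'i, 'k) trm set) \<Rightarrow> ('k \<Rightarrow> 'a) \<Rightarrow> ('k \<Rightarrow> 'a)" where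
  "definable_fun T A \<mu> \<nu> h = (\<lambda>a\<in>alg_power A \<nu>. \<lambda>\<beta>\<in>{..<\<mu>}. ev T A \<nu> (h (gen T \<mu> \<beta>)) a)"


section \<open>Categories, functors, adjunctions\<close>

text \<open>
  Categories are given by families of hom-sets, so that arrows need not record their domain and
  codomain.  \<open>Comp x y z g f\<close> is \<open>g \<circ> f\<close> for \<open>f : x \<rightarrow> y\<close> and \<open>g : y \<rightarrow> z\<close>.
\<close>

record ('o, 'm) cat =
  Obj :: "'o set"
  Arr :: "'o \<Rightarrow> 'o \<Rightarrow> 'm set"
  Ident :: "'o \<Rightarrow> 'm"
  Comp :: "'o \<Rightarrow> 'o \<Rightarrow> 'o \<Rightarrow> 'm \<Rightarrow> 'm \<Rightarrow> 'm"

definition is_category :: "('o, 'm) cat \<Rightarrow> bool" where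
  "is_category K \<longleftrightarrow>
    (\<forall>x\<in>Obj K. Ident K x \<in> Arr K x x) \<and>
    (\<forall>x\<in>Obj K. \<forall>y\<in>Obj K. \<forall>z\<in>Obj K. \<forall>f\<in>Arr K x y. \<forall>g\<in>Arr K y z.
      Comp K x y z g f \<in> Arr K x z) \<and>
    (\<forall>x\<in>Obj K. \<forall>y\<in>Obj K. \<forall>f\<in>Arr K x y.
      Comp K x x y f (Ident K x) = f \<and> Comp K x y y (Ident K y) f = f) \<and>
    (\<forall>w\<in>Obj K. \<forall>x\<in>Obj K. \<forall>y\<in>Obj K. \<forall>z\<in>Obj K.
      \<forall>f\<in>Arr K w x. \<forall>g\<in>Arr K x y. \<forall>h\<in>Arr K y z.
        Comp K w y z h (Comp K w x y g f) = Comp K w x z (Comp K x y z h g) f)"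

definition op_cat :: "('o, 'm) cat \<Rightarrow> ('o, 'm) cat" where
  "op_cat K = \<lparr>Obj = Obj K, Arr = (\<lambda>x y. Arr K y x), Ident = Ident K,
    Comp = (\<lambda>x y z g f. Comp K z y x f g)\<rparr>"

record ('o, 'm, 'p, 'n) cat_functor =
  on_obj :: "'o \<Rightarrow> 'p"
  on_arr :: "'o \<Rightarrow> 'o \<Rightarrow> 'm \<Rightarrow> 'n"

definition is_functor :: "('o, 'm) cat \<Rightarrow> ('p, 'n) cat \<Rightarrow> ('o, 'm, 'p, 'n) cat_functor \<Rightarrow> bool" where
  "is_functor K L F \<longleftrightarrow>
    (\<forall>x\<in>Obj K. on_obj F x \<in> Obj L) \<and>
    (\<forall>x\<in>Obj K. \<forall>y\<in>Obj K. \<forall>f\<in>Arr K x y. on_arr F x y f \<in> Arr L (on_obj F x) (on_obj F y)) \<and>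
    (\<forall>x\<in>Obj K. on_arr F x x (Ident K x) = Ident L (on_obj F x)) \<and>
    (\<forall>x\<in>Obj K. \<forall>y\<in>Obj K. \<forall>z\<in>Obj K. \<forall>f\<in>Arr K x y. \<forall>g\<in>Arr K y z.
      on_arr F x z (Comp K x y z g f) =
      Comp L (on_obj F x) (on_obj F y) (on_obj F z) (on_arr F y z g) (on_arr F x y f))"

text \<open>\<open>F : K \<rightarrow> L\<close> is left adjoint to \<open>G : L \<rightarrow> K\<close>: a bijection \<open>L(F x, y) \<cong> K(x, G y)\<close> natural in both
  arguments.\<close>

definition adjunction ::
  "('o, 'm) cat \<Rightarrow> ('p, 'n) cat \<Rightarrow> ('o, 'm, 'p, 'n) cat_functor \<Rightarrow> ('p, 'n, 'o, 'm) cat_functor \<Rightarrow> bool"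
  where
  "adjunction K L F G \<longleftrightarrow>
    is_category K \<and> is_category L \<and> is_functor K L F \<and> is_functor L K G \<and>
    (\<exists>\<phi>.
      (\<forall>x\<in>Obj K. \<forall>y\<in>Obj L.
        bij_betw (\<phi> x y) (Arr L (on_obj F x) y) (Arr K x (on_obj G y))) \<and>
      (\<forall>x\<in>Obj K. \<forall>x'\<in>Obj K. \<forall>y\<in>Obj L. \<forall>y'\<in>Obj L.
        \<forall>f\<in>Arr K x' x. \<forall>g\<in>Arr L y y'. \<forall>u\<in>Arr L (on_obj F x) y.
          \<phi> x' y' (Comp L (on_obj F x') y y' g
                    (Comp L (on_obj F x') (on_obj F x) y u (on_arr F x' x f))) =
          Comp K x' (on_obj G y) (on_obj G y') (on_arr G y y' g)
            (Comp K x' x (on_obj G y) (\<phi> x y u) f)))"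


section \<open>The two categories and the two functors\<close>

type_synonym ('f, 'i, 'k) pres = "'k \<times> (('f, 'i, 'k) trm set \<times> ('f, 'i, 'k) trm set) set"
type_synonym ('f, 'i, 'k) pres_arr = "('f, 'i, 'k) trm set set \<Rightarrow> ('f, 'i, 'k) trm set set"
type_synonym ('k, 'a) subobj = "'k \<times> ('k \<Rightarrow> 'a) set"
type_synonym ('k, 'a) subobj_arr = "('k \<Rightarrow> 'a) \<Rightarrow> ('k \<Rightarrow> 'a)"

definition pres_alg ::
  "('f, 'i, 'v) eq_theory \<Rightarrow> ('f, 'i, 'k::wellorder) pres
    \<Rightarrow> ('f, 'i, ('f, 'i, 'k) trm set set) algebra" where
  "pres_alg T P = quot_alg T (free_alg T (fst P)) (snd P)"

definition presented_cat ::
  "('f, 'i, 'v) eq_theory \<Rightarrow> (('f, 'i, 'k::wellorder) pres, ('f, 'i, 'k) pres_arr) cat" where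
  "presented_cat T = \<lparr>
    Obj = {(\<mu>, \<theta>). is_cardinal \<mu> \<and> congruence T (free_alg T \<mu>) \<theta>},
    Arr = (\<lambda>P Q. hom T (pres_alg T P) (pres_alg T Q)),
    Ident = (\<lambda>P. \<lambda>c\<in>carrier (pres_alg T P). c),
    Comp = (\<lambda>P Q R l k. compose (carrier (pres_alg T P)) l k)\<rparr>"

definition definable_cat ::
  "('f, 'i, 'v) eq_theory \<Rightarrow> ('f, 'i, 'a) algebra
    \<Rightarrow> (('k::wellorder, 'a) subobj, ('k, 'a) subobj_arr) cat" where
  "definable_cat T A = \<lparr>
    Obj = {(\<mu>, S). is_cardinal \<mu> \<and> S \<subseteq> alg_power A \<mu>},
    Arr = (\<lambda>(\<nu>, S') (\<mu>, S). {g \<in> S' \<rightarrow>\<^sub>E S.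
      \<exists>h\<in>hom T (free_alg T \<mu>) (free_alg T \<nu>). g = restrict (definable_fun T A \<mu> \<nu> h) S'}),
    Ident = (\<lambda>(\<mu>, S). \<lambda>a\<in>S. a),
    Comp = (\<lambda>(\<nu>, S) _ _ g f. compose S g f)\<rparr>"

definition cong_of ::
  "('f, 'i, 'v) eq_theory \<Rightarrow> ('f, 'i, 'a) algebra \<Rightarrow> 'k::wellorder \<Rightarrow> ('k \<Rightarrow> 'a) set
    \<Rightarrow> (('f, 'i, 'k) trm set \<times> ('f, 'i, 'k) trm set) set" where
  "cong_of T A \<mu> S = {(p, q). p \<in> carrier (free_alg T \<mu>) \<and> q \<in> carrier (free_alg T \<mu>) \<and>
    (\<forall>a\<in>S. ev T A \<mu> p a = ev T A \<mu> q a)}"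

definition zeros_of ::
  "('f, 'i, 'v) eq_theory \<Rightarrow> ('f, 'i, 'a) algebra \<Rightarrow> 'k::wellorder
    \<Rightarrow> (('f, 'i, 'k) trm set \<times> ('f, 'i, 'k) trm set) set \<Rightarrow> ('k \<Rightarrow> 'a) set" where
  "zeros_of T A \<mu> R = {a \<in> alg_power A \<mu>. \<forall>(p, q)\<in>R. ev T A \<mu> p a = ev T A \<mu> q a}"

text \<open>\<open>h : F \<mu> \<rightarrow> F \<nu>\<close> induces \<open>k : F \<mu> / \<theta> \<rightarrow> F \<nu> / \<theta>'\<close>.\<close>

definition induces ::
  "('f, 'i, 'v) eq_theory \<Rightarrow> ('f, 'i, 'k::wellorder) pres \<Rightarrow> ('f, 'i, 'k) pres
    \<Rightarrow> (('f, 'i, 'k) trm set \<Rightarrow> ('f, 'i, 'k) trm set) \<Rightarrow> ('f, 'i, 'k) pres_arr \<Rightarrow> bool" where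
  "induces T P Q h k \<longleftrightarrow>
    h \<in> hom T (free_alg T (fst P)) (free_alg T (fst Q)) \<and>
    k \<in> hom T (pres_alg T P) (pres_alg T Q) \<and>
    (\<forall>p\<in>carrier (free_alg T (fst P)). k (snd P `` {p}) = snd Q `` {h p})"

text \<open>
  The arrow maps are given by definite descriptions, expressing that the value does not depend on
  the choice of the inducing homomorphism \<open>h\<close>.
\<close>

definition C_obj ::
  "('f, 'i, 'v) eq_theory \<Rightarrow> ('f, 'i, 'a) algebra \<Rightarrow> ('k::wellorder, 'a) subobj
    \<Rightarrow> ('f, 'i, 'k) pres" where
  "C_obj T A = (\<lambda>(\<mu>, S). (\<mu>, cong_of T A \<mu> S))"

definition V_obj ::
  "('f, 'i, 'v) eq_theory \<Rightarrow> ('f, 'i, 'a) algebra \<Rightarrow> ('f, 'i, 'k::wellorder) pres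
    \<Rightarrow> ('k, 'a) subobj" where
  "V_obj T A = (\<lambda>(\<mu>, \<theta>). (\<mu>, zeros_of T A \<mu> \<theta>))"

text \<open>
  For an arrow from \<open>S' \<subseteq> A\<^sup>\<nu>\<close> to \<open>S \<subseteq> A\<^sup>\<mu>\<close>, the arguments \<open>x\<close>, \<open>y\<close> of \<open>on_arr\<close> are \<open>(\<nu>, S')\<close>, \<open>(\<mu>, S)\<close>.
\<close>

definition C_functor ::
  "('f, 'i, 'v) eq_theory \<Rightarrow> ('f, 'i, 'a) algebra
    \<Rightarrow> (('k::wellorder, 'a) subobj, ('k, 'a) subobj_arr,
        ('f, 'i, 'k) pres, ('f, 'i, 'k) pres_arr) cat_functor" where
  "C_functor T A = \<lparr>
    on_obj = C_obj T A,
    on_arr = (\<lambda>x y g. THE k. \<exists>h. induces T (C_obj T A y) (C_obj T A x) h k \<and>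
      g = restrict (definable_fun T A (fst y) (fst x) h) (snd x))\<rparr>"

text \<open>
  An arrow \<open>(F \<nu>, \<theta>') \<rightarrow> (F \<mu>, \<theta>)\<close> of the opposite category is a homomorphism
  \<open>k : F \<mu> / \<theta> \<rightarrow> F \<nu> / \<theta>'\<close>; here \<open>Q = (\<nu>, \<theta>')\<close> and \<open>P = (\<mu>, \<theta>)\<close>.
\<close>

definition V_functor ::
  "('f, 'i, 'v) eq_theory \<Rightarrow> ('f, 'i, 'a) algebra
    \<Rightarrow> (('f, 'i, 'k::wellorder) pres, ('f, 'i, 'k) pres_arr,
        ('k, 'a) subobj, ('k, 'a) subobj_arr) cat_functor" where
  "V_functor T A = \<lparr>
    on_obj = V_obj T A,
    on_arr = (\<lambda>Q P k. THE g. \<exists>h. induces T P Q h k \<and>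
      g = restrict (definable_fun T A (fst P) (fst Q) h) (snd (V_obj T A Q)))\<rparr>"

end

theory Submission
  imports Defs
begin

text \<open>
  A homomorphism \<open>h : F \<mu> \<rightarrow> F \<nu>\<close> satisfies \<open>ev (h p) a = ev p (D h a)\<close>, where \<open>D h\<close> is the definable
  function induced by \<open>h\<close>.  For \<open>S \<subseteq> A\<^sup>\<nu>\<close> and a congruence \<open>\<theta>\<close> on \<open>F \<mu>\<close> it follows that \<open>D h\<close> maps \<open>S\<close>
  into the zeros of \<open>\<theta>\<close> iff \<open>h\<close> maps \<open>\<theta>\<close> into the congruence of \<open>S\<close>, i.e. iff \<open>h\<close> induces a homomorphism
  between the quotients.  Moreover \<open>h\<close> and \<open>h'\<close> induce the same homomorphism iff \<open>D h\<close> and \<open>D h'\<close> agree on \<open>S\<close>.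
  The resulting bijection of hom-sets is natural because \<open>D\<close> is contravariantly functorial.
\<close>

section \<open>Homomorphisms and quotients\<close>

lemma hom_closed: "h \<in> hom T B D \<Longrightarrow> x \<in> carrier B \<Longrightarrow> h x \<in> carrier D"
  unfolding hom_def by auto

lemma hom_oper:
  "h \<in> hom T B D \<Longrightarrow> f \<in> symbols T \<Longrightarrow> xs \<in> arity T f \<rightarrow>\<^sub>E carrier B
    \<Longrightarrow> h (oper B f xs) = oper D f (\<lambda>i\<in>arity T f. h (xs i))"
  unfolding hom_def by blast

lemma hom_eqI:
  assumes "h \<in> hom T B D" "k \<in> hom T B D" "\<And>x. x \<in> carrier B \<Longrightarrow> h x = k x"
  shows "h = k"
  using assms PiE_ext[of h "carrier B" "\<lambda>_. carrier D" k] unfolding hom_def by blast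

lemma hom_id:
  assumes "is_algebra T B"
  shows "(\<lambda>x\<in>carrier B. x) \<in> hom T B B"
  unfolding hom_def
proof (intro CollectI conjI ballI)
  fix f xs assume f: "f \<in> symbols T" and xs: "xs \<in> arity T f \<rightarrow>\<^sub>E carrier B"
  have "(\<lambda>i\<in>arity T f. (\<lambda>x\<in>carrier B. x) (xs i)) = xs"
    using xs by (auto simp: fun_eq_iff PiE_iff extensional_def)
  then show "(\<lambda>x\<in>carrier B. x) (oper B f xs) = oper B f (\<lambda>i\<in>arity T f. (\<lambda>x\<in>carrier B. x) (xs i))"
    using assms f xs unfolding is_algebra_def by simp
qed auto

lemma hom_compose:
  assumes h: "h \<in> hom T B D" and k: "k \<in> hom T D E" and B: "is_algebra T B"
  shows "compose (carrier B) k h \<in> hom T B E"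
  unfolding hom_def
proof (intro CollectI conjI ballI)
  show "compose (carrier B) k h \<in> carrier B \<rightarrow>\<^sub>E carrier E"
    using hom_closed[OF h] hom_closed[OF k] by (auto simp: compose_def)
  fix f xs assume f: "f \<in> symbols T" and xs: "xs \<in> arity T f \<rightarrow>\<^sub>E carrier B"
  have "(\<lambda>i\<in>arity T f. h (xs i)) \<in> arity T f \<rightarrow>\<^sub>E carrier D"
    using xs hom_closed[OF h] by auto
  from hom_oper[OF k f this] hom_oper[OF h f xs]
  have "k (h (oper B f xs)) = oper E f (\<lambda>i\<in>arity T f. k ((\<lambda>i\<in>arity T f. h (xs i)) i))" by simp
  also have "(\<lambda>i\<in>arity T f. k ((\<lambda>i\<in>arity T f. h (xs i)) i))
      = (\<lambda>i\<in>arity T f. compose (carrier B) k h (xs i))"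
    using xs by (intro restrict_ext) (auto simp: compose_def)
  finally have "k (h (oper B f xs)) = oper E f (\<lambda>i\<in>arity T f. compose (carrier B) k h (xs i))" .
  \<comment> \<open>\<open>compose\<close> takes a default value off the carrier of
    \<open>B\<close>; closure of \<open>B\<close> under its operations ensures that this default
    does not occur here.\<close>
  moreover have "oper B f xs \<in> carrier B" using B f xs unfolding is_algebra_def by blast
  ultimately show "compose (carrier B) k h (oper B f xs)
      = oper E f (\<lambda>i\<in>arity T f. compose (carrier B) k h (xs i))"
    by (simp only: compose_eq)
qed

lemma congruence_equiv: "congruence T B \<theta> \<Longrightarrow> equiv (carrier B) \<theta>"
  unfolding congruence_def by blast

lemma carrier_quot_alg: "carrier (quot_alg T B \<theta>) = carrier B // \<theta>"
  by (simp add: quot_alg_def)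

text \<open>Since \<open>\<theta>\<close> is a congruence, operations on classes may be computed on
  any representatives, in particular on the elements \<open>xs i\<close> themselves.\<close>

lemma hom_quot_proj:
  assumes B: "is_algebra T B" and cg: "congruence T B \<theta>"
  shows "(\<lambda>x\<in>carrier B. \<theta> `` {x}) \<in> hom T B (quot_alg T B \<theta>)"
  unfolding hom_def
proof (intro CollectI conjI ballI)
  show "(\<lambda>x\<in>carrier B. \<theta> `` {x}) \<in> carrier B \<rightarrow>\<^sub>E carrier (quot_alg T B \<theta>)"
    by (auto simp: carrier_quot_alg intro: quotientI)
  fix f xs assume f: "f \<in> symbols T" and xs: "xs \<in> arity T f \<rightarrow>\<^sub>E carrier B"
  have "oper (quot_alg T B \<theta>) f (\<lambda>i\<in>arity T f. (\<lambda>x\<in>carrier B. \<theta> `` {x}) (xs i))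
      = \<theta> `` {oper B f xs}"
    using xs by (intro oper_quot_alg[OF cg f xs]) auto
  then show "(\<lambda>x\<in>carrier B. \<theta> `` {x}) (oper B f xs)
      = oper (quot_alg T B \<theta>) f (\<lambda>i\<in>arity T f. (\<lambda>x\<in>carrier B. \<theta> `` {x}) (xs i))"
    using B f xs unfolding is_algebra_def by simp
qed

text \<open>The universal property of the quotient: as \<open>h\<close> is constant on classes, its
  value at a chosen representative does not depend on the choice.\<close>

lemma hom_quot_factor:
  assumes B: "is_algebra T B" and cg: "congruence T B \<theta>" and h: "h \<in> hom T B D"
    and eq: "\<And>p q. (p, q) \<in> \<theta> \<Longrightarrow> h p = h q"
  obtains k where "k \<in> hom T (quot_alg T B \<theta>) D" "\<And>p. p \<in> carrier B \<Longrightarrow> k (\<theta> `` {p}) = h p"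
proof
  let ?k = "\<lambda>c\<in>carrier B // \<theta>. h (SOME p. p \<in> c)"
  note some = some_in_class[OF congruence_equiv[OF cg]]
  show val: "?k (\<theta> `` {p}) = h p" if p: "p \<in> carrier B" for p
  proof -
    have c: "\<theta> `` {p} \<in> carrier B // \<theta>" using p by (rule quotientI)
    then have "(SOME q. q \<in> \<theta> `` {p}, p) \<in> \<theta>"
      using some[OF c] p eq_equiv_class_iff[OF congruence_equiv[OF cg]] by blast
    then show ?thesis using c eq by auto
  qed
  show "?k \<in> hom T (quot_alg T B \<theta>) D"
    unfolding hom_def carrier_quot_alg
  proof (intro CollectI conjI ballI)
    show "?k \<in> carrier B // \<theta> \<rightarrow>\<^sub>E carrier D" using some(1) hom_closed[OF h] by auto
    fix f cs assume f: "f \<in> symbols T" and cs: "cs \<in> arity T f \<rightarrow>\<^sub>E carrier B // \<theta>"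
    define xs where "xs = (\<lambda>i\<in>arity T f. SOME x. x \<in> cs i)"
    have xs: "xs \<in> arity T f \<rightarrow>\<^sub>E carrier B" using cs some(1) by (auto simp: xs_def)
    \<comment> \<open>The operation of the quotient uses the same chosen representatives as
      \<open>?k\<close>, so this holds by definition.\<close>
    have "?k (oper (quot_alg T B \<theta>) f cs) = ?k (\<theta> `` {oper B f xs})"
      by (simp add: quot_alg_def xs_def)
    also have "\<dots> = h (oper B f xs)"
      using B f xs by (intro val) (auto simp: is_algebra_def)
    also have "\<dots> = oper D f (\<lambda>i\<in>arity T f. h (xs i))" by (rule hom_oper[OF h f xs])
    also have "(\<lambda>i\<in>arity T f. h (xs i)) = (\<lambda>i\<in>arity T f. ?k (cs i))"
      using cs by (intro restrict_ext) (auto simp: xs_def)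
    finally show "?k (oper (quot_alg T B \<theta>) f cs) = oper D f (\<lambda>i\<in>arity T f. ?k (cs i))" .
  qed
qed

section \<open>Quotients within the variety and maps out of free algebras\<close>

text \<open>A valuation in the quotient lifts to \<open>B\<close> by choosing representatives. The
  equations hold in \<open>B\<close> under the lift, and evaluation commutes with passing to
  classes. Thus presented algebras may serve as targets of the universal property of free
  algebras.\<close>

lemma in_variety_quot_alg:
  assumes wf: "wf_theory T" and B: "in_variety T B" and cg: "congruence T B \<theta>"
  shows "in_variety T (quot_alg T B \<theta>)"
  unfolding in_variety_def
proof (intro conjI ballI, goal_cases)
  case 1
  show ?case using B cg by (simp add: in_variety_def is_algebra_quot_alg)
next
  case (2 e)
  obtain s t where e: "e = (s, t)" by force
  then have st: "s \<in> terms T UNIV" "t \<in> terms T UNIV"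
    using 2 wf unfolding wf_theory_def by auto
  have "eval T (quot_alg T B \<theta>) \<rho> s = eval T (quot_alg T B \<theta>) \<rho> t"
    if \<rho>: "\<rho> \<in> UNIV \<rightarrow> carrier (quot_alg T B \<theta>)" for \<rho>
  proof -
    define \<sigma> where "\<sigma> v = (SOME x. x \<in> \<rho> v)" for v
    have "\<rho> v \<in> carrier B // \<theta>" for v using \<rho> by (auto simp: carrier_quot_alg)
    note some_in_class[OF congruence_equiv[OF cg] this, folded \<sigma>_def]
    then have \<sigma>: "\<sigma> \<in> UNIV \<rightarrow> carrier B" "\<rho> v = \<theta> `` {\<sigma> v}" for v by auto
    have "is_algebra T B" using B by (simp add: in_variety_def)
    from eval_quot_alg[OF this cg _ \<sigma>(1), of _ \<rho>] \<sigma>(2) st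
    have "eval T (quot_alg T B \<theta>) \<rho> u = \<theta> `` {eval T B \<sigma> u}" if "u \<in> {s, t}" for u
      using that by blast
    moreover have "eval T B \<sigma> s = eval T B \<sigma> t" using B 2 e \<sigma>(1) unfolding in_variety_def by blast
    ultimately show ?thesis by simp
  qed
  then show ?case using e by simp
qed

lemma gen_in_free_alg: "\<beta> < \<nu> \<Longrightarrow> gen T \<nu> \<beta> \<in> carrier (free_alg T \<nu>)"
  by (auto simp: gen_def free_alg_def carrier_quot_alg term_alg_def intro!: quotientI terms.Var)

lemma is_algebra_free_alg: "wf_theory T \<Longrightarrow> is_algebra T (free_alg T \<nu>)"
  using in_variety_free_alg unfolding in_variety_def by blast

text \<open>The uniqueness half of the universal property: both homomorphisms extend the same tuple
  of values on the generators.\<close>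

lemma free_hom_eqI:
  assumes wf: "wf_theory T" and B: "in_variety T B"
    and h: "h \<in> hom T (free_alg T \<nu>) B" and k: "k \<in> hom T (free_alg T \<nu>) B"
    and eq: "\<And>\<beta>. \<beta> < \<nu> \<Longrightarrow> h (gen T \<nu> \<beta>) = k (gen T \<nu> \<beta>)"
  shows "h = k"
proof -
  \<comment> \<open>Restriction to the index set makes the tuple extensional, as membership in
    \<open>alg_power\<close> demands.\<close>
  let ?a = "\<lambda>\<beta>\<in>{..<\<nu>}. k (gen T \<nu> \<beta>)"
  have "?a \<in> alg_power B \<nu>"
    using hom_closed[OF k gen_in_free_alg] by (auto simp: alg_power_def)
  from free_alg_universal[OF wf B this] h k eq show ?thesis by auto
qed

section \<open>Induced homomorphisms\<close>

text \<open>Related elements have the same class, and \<open>k\<close> sends this one class both to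
  the class of \<open>h p\<close> and to the class of \<open>h q\<close>.\<close>

lemma induces_respects:
  assumes P: "congruence T (free_alg T (fst P)) (snd P)"
    and Q: "congruence T (free_alg T (fst Q)) (snd Q)"
    and hk: "induces T P Q h k" and pq: "(p, q) \<in> snd P"
  shows "(h p, h q) \<in> snd Q"
proof -
  have "p \<in> carrier (free_alg T (fst P))" "q \<in> carrier (free_alg T (fst P))"
    using pq congruence_equiv[OF P] unfolding equiv_def refl_on_def by auto
  moreover have "snd P `` {p} = snd P `` {q}" using equiv_class_eq[OF congruence_equiv[OF P] pq] .
  ultimately show ?thesis
    using hk eq_equiv_class_iff[OF congruence_equiv[OF Q]] hom_closed
    unfolding induces_def by metis
qed

text \<open>Every element of the quotient is the class of some \<open>p\<close>, so \<open>h\<close>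
  modulo the target congruence determines the arrow. For \<open>h' = h\<close> this yields the laws
  of \<open>C_functor\<close>, where one homomorphism induces both sides.\<close>

lemma induces_arr_unique:
  assumes "induces T P Q h k" "induces T P Q h' k'"
    and "\<And>p. p \<in> carrier (free_alg T (fst P)) \<Longrightarrow> snd Q `` {h p} = snd Q `` {h' p}"
  shows "k = k'"
proof (rule hom_eqI)
  show "k \<in> hom T (pres_alg T P) (pres_alg T Q)" "k' \<in> hom T (pres_alg T P) (pres_alg T Q)"
    using assms unfolding induces_def by blast+
  fix c assume "c \<in> carrier (pres_alg T P)"
  then obtain p where "p \<in> carrier (free_alg T (fst P))" "c = snd P `` {p}"
    unfolding pres_alg_def carrier_quot_alg by (rule quotientE)
  then show "k c = k' c" using assms unfolding induces_def by metis
qed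

section \<open>Lifting homomorphisms between presentations to free algebras\<close>

context
  fixes T :: "('f, 'i, 'v) eq_theory"
  assumes wf: "wf_theory T"
begin

lemma is_algebra_pres_alg:
  "congruence T (free_alg T (fst P)) (snd P) \<Longrightarrow> is_algebra T (pres_alg T P)"
  unfolding pres_alg_def using is_algebra_free_alg[OF wf] by (rule is_algebra_quot_alg)

text \<open>Following \<open>h\<close> by the projection of the target gives a homomorphism that is
  constant on the classes of the source, hence factors through them.\<close>

lemma induces_ex_arr:
  assumes P: "congruence T (free_alg T (fst P)) (snd P)"
    and Q: "congruence T (free_alg T (fst Q)) (snd Q)"
    and h: "h \<in> hom T (free_alg T (fst P)) (free_alg T (fst Q))"
    and resp: "\<And>p q. (p, q) \<in> snd P \<Longrightarrow> (h p, h q) \<in> snd Q"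
  shows "\<exists>k. induces T P Q h k"
proof -
  let ?F = "free_alg T (fst P)" and ?G = "free_alg T (fst Q)"
  let ?j = "\<lambda>x\<in>carrier ?G. snd Q `` {x}"
  have j: "compose (carrier ?F) ?j h \<in> hom T ?F (pres_alg T Q)"
    unfolding pres_alg_def
    using hom_compose[OF h hom_quot_proj[OF is_algebra_free_alg[OF wf] Q] is_algebra_free_alg[OF wf]] .
  have val: "compose (carrier ?F) ?j h p = snd Q `` {h p}" if "p \<in> carrier ?F" for p
    using that hom_closed[OF h that] by (simp add: compose_def)
  have "compose (carrier ?F) ?j h p = compose (carrier ?F) ?j h q" if "(p, q) \<in> snd P" for p q
  proof -
    have "p \<in> carrier ?F" "q \<in> carrier ?F"
      using that congruence_equiv[OF P] unfolding equiv_def refl_on_def by auto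
    then show ?thesis
      using val equiv_class_eq[OF congruence_equiv[OF Q] resp[OF that]] by simp
  qed
  from hom_quot_factor[OF is_algebra_free_alg[OF wf] P j this]
  obtain k where "k \<in> hom T (pres_alg T P) (pres_alg T Q)"
    "\<And>p. p \<in> carrier ?F \<Longrightarrow> k (snd P `` {p}) = compose (carrier ?F) ?j h p"
    unfolding pres_alg_def by metis
  then show ?thesis using h val unfolding induces_def by auto
qed

text \<open>Free algebras are projective with respect to quotient maps: choose representatives of
  the images under \<open>k\<close> of the classes of generators, and extend the choice to
  \<open>h\<close> by freeness.\<close>

lemma induces_ex_free:
  assumes P: "congruence T (free_alg T (fst P)) (snd P)"
    and Q: "congruence T (free_alg T (fst Q)) (snd Q)"
    and k: "k \<in> hom T (pres_alg T P) (pres_alg T Q)"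
  shows "\<exists>h. induces T P Q h k"
proof -
  let ?F = "free_alg T (fst P)" and ?G = "free_alg T (fst Q)"
  let ?i = "\<lambda>x\<in>carrier ?F. snd P `` {x}" and ?j = "\<lambda>x\<in>carrier ?G. snd Q `` {x}"
  let ?b = "\<lambda>\<beta>\<in>{..<fst P}. SOME q. q \<in> k (snd P `` {gen T (fst P) \<beta>})"
  have "snd P `` {gen T (fst P) \<beta>} \<in> carrier (pres_alg T P)" if "\<beta> < fst P" for \<beta>
    unfolding pres_alg_def carrier_quot_alg using gen_in_free_alg[OF that] by (rule quotientI)
  from hom_closed[OF k this]
  have "k (snd P `` {gen T (fst P) \<beta>}) \<in> carrier ?G // snd Q" if "\<beta> < fst P" for \<beta>
    using that by (simp add: pres_alg_def carrier_quot_alg)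
  from some_in_class[OF congruence_equiv[OF Q] this]
  have b: "?b \<beta> \<in> carrier ?G" "snd Q `` {?b \<beta>} = k (snd P `` {gen T (fst P) \<beta>})"
    if "\<beta> < fst P" for \<beta>
    using that by simp_all
  then have "?b \<in> alg_power ?G (fst P)" unfolding alg_power_def by (intro PiE_I) auto
  from free_alg_universal[OF wf in_variety_free_alg[OF wf] this]
  obtain h where h: "h \<in> hom T ?F ?G" "\<And>\<beta>. \<beta> < fst P \<Longrightarrow> h (gen T (fst P) \<beta>) = ?b \<beta>" by metis
  \<comment> \<open>The square formed by \<open>h\<close>, \<open>k\<close> and the two projections
    commutes, because both paths agree on generators and \<open>pres_alg T Q\<close> lies in the
    variety.\<close>
  have "compose (carrier ?F) k ?i = compose (carrier ?F) ?j h"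
  proof (rule free_hom_eqI[OF wf])
    show "in_variety T (pres_alg T Q)"
      unfolding pres_alg_def by (rule in_variety_quot_alg[OF wf in_variety_free_alg[OF wf] Q])
    show "compose (carrier ?F) k ?i \<in> hom T ?F (pres_alg T Q)"
      using hom_compose[OF hom_quot_proj[OF is_algebra_free_alg[OF wf] P] k[unfolded pres_alg_def]
          is_algebra_free_alg[OF wf]] by (simp add: pres_alg_def)
    show "compose (carrier ?F) ?j h \<in> hom T ?F (pres_alg T Q)"
      unfolding pres_alg_def
      using hom_compose[OF h(1) hom_quot_proj[OF is_algebra_free_alg[OF wf] Q]
          is_algebra_free_alg[OF wf]] .
    show "compose (carrier ?F) k ?i (gen T (fst P) \<beta>) = compose (carrier ?F) ?j h (gen T (fst P) \<beta>)"
      if "\<beta> < fst P" for \<beta>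
      unfolding compose_eq[OF gen_in_free_alg[OF that]] h(2)[OF that] restrict_apply'[OF b(1)[OF that]]
        restrict_apply'[OF gen_in_free_alg[OF that]] b(2)[OF that] ..
  qed
  then have "k (?i p) = ?j (h p)" if "p \<in> carrier ?F" for p
    using that by (auto simp only: compose_eq dest: fun_cong[of _ _ p])
  then have "k (snd P `` {p}) = snd Q `` {h p}" if "p \<in> carrier ?F" for p
    using that hom_closed[OF h(1) that] by simp
  then show ?thesis using h(1) k unfolding induces_def by blast
qed

text \<open>Two commuting squares are pasted along the projection for \<open>Q\<close>.
  Functoriality and naturality both rest on this.\<close>

lemma induces_compose:
  assumes P: "congruence T (free_alg T (fst P)) (snd P)"
    and 1: "induces T P Q h k" and 2: "induces T Q R h' k'"
  shows "induces T P R (compose (carrier (free_alg T (fst P))) h' h)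
    (compose (carrier (pres_alg T P)) k' k)"
proof -
  have hom: "h \<in> hom T (free_alg T (fst P)) (free_alg T (fst Q))"
    "k \<in> hom T (pres_alg T P) (pres_alg T Q)"
    "h' \<in> hom T (free_alg T (fst Q)) (free_alg T (fst R))"
    "k' \<in> hom T (pres_alg T Q) (pres_alg T R)"
    using 1 2 unfolding induces_def by blast+
  have "compose (carrier (pres_alg T P)) k' k (snd P `` {p})
      = snd R `` {compose (carrier (free_alg T (fst P))) h' h p}"
    if p: "p \<in> carrier (free_alg T (fst P))" for p
  proof -
    have "snd P `` {p} \<in> carrier (pres_alg T P)"
      unfolding pres_alg_def carrier_quot_alg using p by (rule quotientI)
    moreover have "k (snd P `` {p}) = snd Q `` {h p}" using 1 p unfolding induces_def by blast
    moreover have "k' (snd Q `` {h p}) = snd R `` {h' (h p)}"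
      using 2 hom_closed[OF hom(1) p] unfolding induces_def by blast
    ultimately show ?thesis using p by (simp add: compose_eq)
  qed
  then show ?thesis
    using hom_compose[OF hom(1,3) is_algebra_free_alg[OF wf]]
      hom_compose[OF hom(2,4) is_algebra_pres_alg[OF P]]
    unfolding induces_def by blast
qed

lemma induces_id:
  assumes P: "congruence T (free_alg T (fst P)) (snd P)"
  shows "induces T P P (\<lambda>p\<in>carrier (free_alg T (fst P)). p) (\<lambda>c\<in>carrier (pres_alg T P). c)"
  unfolding induces_def
  using hom_id[OF is_algebra_free_alg[OF wf]] hom_id[OF is_algebra_pres_alg[OF P]]
  by (simp add: pres_alg_def carrier_quot_alg quotientI)

section \<open>The category of presentations\<close>

lemma is_category_presented_cat:
  "is_category (presented_cat T :: (('f, 'i, 'k::wellorder) pres, ('f, 'i, 'k) pres_arr) cat)"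
proof -
  let ?K = "presented_cat T :: (('f, 'i, 'k) pres, ('f, 'i, 'k) pres_arr) cat"
  have alg: "is_algebra T (pres_alg T P)" if "P \<in> Obj ?K" for P
    using that by (intro is_algebra_pres_alg) (auto simp: presented_cat_def)
  have arr: "Arr ?K P Q = hom T (pres_alg T P) (pres_alg T Q)" for P Q
    by (simp add: presented_cat_def)
  \<comment> \<open>Extensionality turns the identity laws, which concern the carrier only, into
    equations of functions.\<close>
  have ext: "k \<in> carrier (pres_alg T P) \<rightarrow>\<^sub>E carrier (pres_alg T Q)" if "k \<in> Arr ?K P Q" for P Q k
    using that unfolding arr hom_def by blast
  have "Ident ?K P \<in> Arr ?K P P" if "P \<in> Obj ?K" for P
    using hom_id[OF alg[OF that]] by (simp add: presented_cat_def)
  moreover have "Comp ?K P Q R l k \<in> Arr ?K P R"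
    if "P \<in> Obj ?K" "k \<in> Arr ?K P Q" "l \<in> Arr ?K Q R" for P Q R k l
    using hom_compose[OF that(2,3)[unfolded arr] alg[OF that(1)]] by (simp add: presented_cat_def)
  moreover have "Comp ?K P P Q k (Ident ?K P) = k" "Comp ?K P Q Q (Ident ?K Q) k = k"
    if "k \<in> Arr ?K P Q" for P Q k
    using ext[OF that]
    by (auto simp: presented_cat_def compose_def fun_eq_iff PiE_iff extensional_def)
  moreover have "Comp ?K P Q S m (Comp ?K P Q R l k) = Comp ?K P R S (Comp ?K Q R S m l) k"
    if "k \<in> Arr ?K P Q" for P Q R S k l m
    using ext[OF that] by (auto simp: presented_cat_def compose_def fun_eq_iff)
  ultimately show ?thesis
    unfolding is_category_def by (simp add: presented_cat_def)
qed

end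

lemma is_category_op_cat: "is_category K \<Longrightarrow> is_category (op_cat K)"
  unfolding is_category_def op_cat_def by auto

section \<open>The two categories\<close>

text \<open>This and the following facts replace pattern matching by projections, so that they
  rewrite objects that are not given as explicit pairs.\<close>

lemma C_obj_eq: "C_obj T A x = (fst x, cong_of T A (fst x) (snd x))"
  by (simp add: C_obj_def case_prod_beta)

lemma V_obj_eq: "V_obj T A P = (fst P, zeros_of T A (fst P) (snd P))"
  by (simp add: V_obj_def case_prod_beta)

lemma on_obj_C_functor: "on_obj (C_functor T A) = C_obj T A"
  by (simp add: C_functor_def)

lemma on_obj_V_functor: "on_obj (V_functor T A) = V_obj T A"
  by (simp add: V_functor_def)

lemma definable_obj_iff:
  "x \<in> Obj (definable_cat T A) \<longleftrightarrow> is_cardinal (fst x) \<and> snd x \<subseteq> alg_power A (fst x)"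
  by (cases x) (simp add: definable_cat_def)

lemma definable_arr_iff:
  "g \<in> Arr (definable_cat T A) x y \<longleftrightarrow> g \<in> snd x \<rightarrow>\<^sub>E snd y \<and>
    (\<exists>h\<in>hom T (free_alg T (fst y)) (free_alg T (fst x)).
      g = restrict (definable_fun T A (fst y) (fst x) h) (snd x))"
  by (cases x; cases y) (simp add: definable_cat_def)

lemma definable_ident: "Ident (definable_cat T A) x = (\<lambda>a\<in>snd x. a)"
  by (cases x) (simp add: definable_cat_def)

lemma definable_comp: "Comp (definable_cat T A) x y z g f = compose (snd x) g f"
  by (cases x) (simp add: definable_cat_def)

lemma presented_obj_iff:
  "P \<in> Obj (presented_cat T) \<longleftrightarrow> is_cardinal (fst P) \<and> congruence T (free_alg T (fst P)) (snd P)"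
  by (cases P) (simp add: presented_cat_def)

lemma presented_arr: "Arr (presented_cat T) P Q = hom T (pres_alg T P) (pres_alg T Q)"
  by (simp add: presented_cat_def)

lemma presented_ident: "Ident (presented_cat T) P = (\<lambda>c\<in>carrier (pres_alg T P). c)"
  by (simp add: presented_cat_def)

lemma presented_comp: "Comp (presented_cat T) P Q R l k = compose (carrier (pres_alg T P)) l k"
  by (simp add: presented_cat_def)

lemmas cat_simps =
  definable_obj_iff definable_ident definable_comp
  presented_obj_iff presented_arr presented_ident presented_comp

section \<open>Evaluation and definable functions\<close>

lemma zeros_of_subset: "zeros_of T A \<mu> \<theta> \<subseteq> alg_power A \<mu>"
  by (auto simp: zeros_of_def)

text \<open>The unit of the Galois connection between sets of points and relations. It makes facts
  about zeros of \<open>cong_of T A \<nu> S\<close> applicable to the points of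
  \<open>S\<close>.\<close>

lemma subset_zeros_of_cong_of: "S \<subseteq> alg_power A \<nu> \<Longrightarrow> S \<subseteq> zeros_of T A \<nu> (cong_of T A \<nu> S)"
  by (auto simp: zeros_of_def cong_of_def)

context
  fixes T :: "('f, 'i, 'v) eq_theory" and A :: "('f, 'i, 'a) algebra"
  assumes wf: "wf_theory T" and A: "in_variety T A"
begin

text \<open>By the universal property the definite description in \<open>ev\<close> denotes. These
  two properties are all that is used of it afterwards.\<close>

lemma
  assumes a: "a \<in> alg_power A \<nu>"
  shows ev_hom: "(\<lambda>p. ev T A \<nu> p a) \<in> hom T (free_alg T \<nu>) A"
    and ev_gen: "\<beta> < \<nu> \<Longrightarrow> ev T A \<nu> (gen T \<nu> \<beta>) a = a \<beta>"
  using theI'[OF free_alg_universal[OF wf A a]] unfolding ev_def by blast+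

lemma definable_fun_in:
  assumes "h \<in> hom T (free_alg T \<mu>) (free_alg T \<nu>)" "a \<in> alg_power A \<nu>"
  shows "definable_fun T A \<mu> \<nu> h a \<in> alg_power A \<mu>"
  unfolding definable_fun_def restrict_apply'[OF assms(2)] alg_power_def[of A \<mu>]
  using hom_closed[OF ev_hom[OF assms(2)] hom_closed[OF assms(1) gen_in_free_alg]]
  by (intro restrict_PiE_iff[THEN iffD2]) simp

text \<open>As functions of \<open>p\<close> both sides are homomorphisms into \<open>A\<close>. On
  generators they agree by the definition of \<open>definable_fun\<close>, so freeness makes them
  equal.\<close>

lemma ev_definable_fun:
  assumes h: "h \<in> hom T (free_alg T \<mu>) (free_alg T \<nu>)" and a: "a \<in> alg_power A \<nu>"
    and p: "p \<in> carrier (free_alg T \<mu>)"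
  shows "ev T A \<nu> (h p) a = ev T A \<mu> p (definable_fun T A \<mu> \<nu> h a)"
proof -
  have "compose (carrier (free_alg T \<mu>)) (\<lambda>p. ev T A \<nu> p a) h
      = (\<lambda>p. ev T A \<mu> p (definable_fun T A \<mu> \<nu> h a))"
  proof (rule free_hom_eqI[OF wf A])
    show "compose (carrier (free_alg T \<mu>)) (\<lambda>p. ev T A \<nu> p a) h \<in> hom T (free_alg T \<mu>) A"
      by (rule hom_compose[OF h ev_hom[OF a] is_algebra_free_alg[OF wf]])
    show "(\<lambda>p. ev T A \<mu> p (definable_fun T A \<mu> \<nu> h a)) \<in> hom T (free_alg T \<mu>) A"
      by (rule ev_hom[OF definable_fun_in[OF h a]])
    show "compose (carrier (free_alg T \<mu>)) (\<lambda>p. ev T A \<nu> p a) h (gen T \<mu> \<beta>)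
        = ev T A \<mu> (gen T \<mu> \<beta>) (definable_fun T A \<mu> \<nu> h a)" if "\<beta> < \<mu>" for \<beta>
      using that a
      by (simp add: compose_eq[OF gen_in_free_alg[OF that]] ev_gen[OF definable_fun_in[OF h a] that])
        (simp add: definable_fun_def)
  qed
  from fun_cong[OF this, of p] show ?thesis by (simp only: compose_eq[OF p])
qed

text \<open>In each coordinate, \<open>ev_definable_fun\<close> moves the outer homomorphism
  \<open>h'\<close> from the element that is evaluated to the point of evaluation; this reverses the
  order of composition.\<close>

lemma definable_fun_compose:
  assumes "h \<in> hom T (free_alg T \<mu>) (free_alg T \<nu>)" "h' \<in> hom T (free_alg T \<nu>) (free_alg T \<rho>)"
    and "a \<in> alg_power A \<rho>"
  shows "definable_fun T A \<mu> \<rho> (compose (carrier (free_alg T \<mu>)) h' h) a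
    = definable_fun T A \<mu> \<nu> h (definable_fun T A \<nu> \<rho> h' a)"
  unfolding definable_fun_def[of T A \<mu>] restrict_apply'[OF assms(3)]
    restrict_apply'[OF definable_fun_in[OF assms(2,3)]]
  by (intro restrict_ext)
    (simp add: compose_eq gen_in_free_alg ev_definable_fun[OF assms(2,3)] hom_closed[OF assms(1)])

lemma definable_fun_id:
  assumes "a \<in> alg_power A \<mu>"
  shows "definable_fun T A \<mu> \<mu> (\<lambda>p\<in>carrier (free_alg T \<mu>). p) a = a"
  using assms gen_in_free_alg[of _ \<mu> T] ev_gen[OF assms]
  by (auto simp: definable_fun_def fun_eq_iff alg_power_def PiE_iff extensional_def)

text \<open>\<open>cong_of\<close> is the intersection of the kernels of the evaluation
  homomorphisms at the points of \<open>S\<close>, taken within the square of the carrier; for empty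
  \<open>S\<close> it is the whole square.\<close>

lemma congruence_cong_of:
  assumes S: "S \<subseteq> alg_power A \<nu>"
  shows "congruence T (free_alg T \<nu>) (cong_of T A \<nu> S)"
  unfolding congruence_def
proof (intro conjI ballI impI)
  show "equiv (carrier (free_alg T \<nu>)) (cong_of T A \<nu> S)"
    by (rule equivI) (auto simp: cong_of_def refl_on_def sym_def trans_def)
  fix f xs ys assume f: "f \<in> symbols T"
    and xs: "xs \<in> arity T f \<rightarrow>\<^sub>E carrier (free_alg T \<nu>)"
    and ys: "ys \<in> arity T f \<rightarrow>\<^sub>E carrier (free_alg T \<nu>)"
    and eq: "\<forall>i\<in>arity T f. (xs i, ys i) \<in> cong_of T A \<nu> S"
  have "ev T A \<nu> (oper (free_alg T \<nu>) f xs) a = ev T A \<nu> (oper (free_alg T \<nu>) f ys) a"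
    if "a \<in> S" for a
  proof -
    have "(\<lambda>i\<in>arity T f. ev T A \<nu> (xs i) a) = (\<lambda>i\<in>arity T f. ev T A \<nu> (ys i) a)"
      using eq that by (intro restrict_ext) (auto simp: cong_of_def)
    then show ?thesis
      using hom_oper[OF ev_hom f xs] hom_oper[OF ev_hom f ys] S that by (metis subsetD)
  qed
  then show "(oper (free_alg T \<nu>) f xs, oper (free_alg T \<nu>) f ys) \<in> cong_of T A \<nu> S"
    using is_algebra_free_alg[OF wf] f xs ys unfolding is_algebra_def cong_of_def by blast
qed

section \<open>Induced homomorphisms versus definable functions on zero sets\<close>

text \<open>Pairs of the source congruence are carried by \<open>h\<close> to pairs that hold at
  \<open>a\<close>; by \<open>ev_definable_fun\<close> the original pairs then hold at the image of
  \<open>a\<close>. This makes \<open>V_functor\<close> land in the right set.\<close>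

lemma definable_fun_zeros:
  assumes P: "congruence T (free_alg T (fst P)) (snd P)"
    and Q: "congruence T (free_alg T (fst Q)) (snd Q)"
    and hk: "induces T P Q h k" and a: "a \<in> zeros_of T A (fst Q) (snd Q)"
  shows "definable_fun T A (fst P) (fst Q) h a \<in> zeros_of T A (fst P) (snd P)"
proof -
  have h: "h \<in> hom T (free_alg T (fst P)) (free_alg T (fst Q))"
    using hk unfolding induces_def by blast
  have a': "a \<in> alg_power A (fst Q)" using a by (simp add: zeros_of_def)
  have "ev T A (fst P) p (definable_fun T A (fst P) (fst Q) h a)
      = ev T A (fst P) q (definable_fun T A (fst P) (fst Q) h a)" if "(p, q) \<in> snd P" for p q
  proof -
    have "p \<in> carrier (free_alg T (fst P))" "q \<in> carrier (free_alg T (fst P))"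
      using that congruence_equiv[OF P] unfolding equiv_def refl_on_def by auto
    moreover have "ev T A (fst Q) (h p) a = ev T A (fst Q) (h q) a"
      using induces_respects[OF P Q hk that] a by (auto simp: zeros_of_def)
    ultimately show ?thesis using ev_definable_fun[OF h a'] by simp
  qed
  then show ?thesis using definable_fun_in[OF h a'] by (auto simp: zeros_of_def)
qed

text \<open>The values of \<open>h\<close> and \<open>h'\<close> are congruent modulo
  \<open>snd Q\<close>, and a zero of \<open>snd Q\<close> cannot distinguish congruent
  elements.\<close>

lemma definable_fun_unique:
  assumes Q: "congruence T (free_alg T (fst Q)) (snd Q)"
    and h: "induces T P Q h k" and h': "induces T P Q h' k"
    and a: "a \<in> zeros_of T A (fst Q) (snd Q)"
  shows "definable_fun T A (fst P) (fst Q) h a = definable_fun T A (fst P) (fst Q) h' a"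
proof -
  have "ev T A (fst Q) (h p) a = ev T A (fst Q) (h' p) a"
    if "p \<in> carrier (free_alg T (fst P))" for p
  proof -
    have "snd Q `` {h p} = snd Q `` {h' p}" using h h' that unfolding induces_def by metis
    then have "(h p, h' p) \<in> snd Q"
      using h h' that hom_closed eq_equiv_class_iff[OF congruence_equiv[OF Q]]
      unfolding induces_def by metis
    then show ?thesis using a by (auto simp: zeros_of_def)
  qed
  then show ?thesis
    using gen_in_free_alg[of _ "fst P" T] by (auto simp: definable_fun_def fun_eq_iff)
qed

text \<open>The set \<open>S\<close> is left general because the description occurs twice: in
  \<open>V_functor\<close> with the full zero set, and in \<open>adjunct\<close> with a subset of
  it.\<close>

lemma the_definable_fun:
  assumes "congruence T (free_alg T (fst Q)) (snd Q)"
    and "induces T P Q h k" and "S \<subseteq> zeros_of T A (fst Q) (snd Q)"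
  shows "(THE g. \<exists>h. induces T P Q h k \<and> g = restrict (definable_fun T A (fst P) (fst Q) h) S)
    = restrict (definable_fun T A (fst P) (fst Q) h) S"
proof (rule the_equality)
  show "g = restrict (definable_fun T A (fst P) (fst Q) h) S"
    if "\<exists>h. induces T P Q h k \<and> g = restrict (definable_fun T A (fst P) (fst Q) h) S" for g
    using that definable_fun_unique[OF assms(1) _ assms(2)] assms(3)
    by (auto intro!: restrict_ext)
qed (use assms(2) in blast)

text \<open>The converse of \<open>definable_fun_zeros\<close> for congruences of the form
  \<open>cong_of\<close>: a pair that holds at the images of all points of \<open>S\<close> is
  carried by \<open>h\<close> to a pair that holds on \<open>S\<close>. It gives existence for
  \<open>C_functor\<close> and surjectivity of \<open>adjunct\<close>.\<close>

lemma induces_cong_of: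
  assumes P: "congruence T (free_alg T (fst P)) (snd P)" and S: "S \<subseteq> alg_power A \<nu>"
    and h: "h \<in> hom T (free_alg T (fst P)) (free_alg T \<nu>)"
    and zeros: "\<And>a. a \<in> S \<Longrightarrow> definable_fun T A (fst P) \<nu> h a \<in> zeros_of T A (fst P) (snd P)"
  shows "\<exists>k. induces T P (\<nu>, cong_of T A \<nu> S) h k"
proof (rule induces_ex_arr[OF wf P])
  fix p q assume pq: "(p, q) \<in> snd P"
  then have "p \<in> carrier (free_alg T (fst P))" "q \<in> carrier (free_alg T (fst P))"
    using congruence_equiv[OF P] unfolding equiv_def refl_on_def by auto
  moreover have "ev T A \<nu> (h p) a = ev T A \<nu> (h q) a" if "a \<in> S" for a
  proof -
    have "a \<in> alg_power A \<nu>" using that S by blast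
    then show ?thesis
      using zeros[OF that] pq ev_definable_fun[OF h] calculation by (auto simp: zeros_of_def)
  qed
  ultimately show "(h p, h q) \<in> snd (\<nu>, cong_of T A \<nu> S)"
    using hom_closed[OF h] by (simp add: cong_of_def)
qed (use congruence_cong_of[OF S] h in simp_all)

text \<open>If the definable functions agree on \<open>S\<close>, then \<open>h p\<close> and
  \<open>h' p\<close> evaluate equally on \<open>S\<close>, which is congruence modulo
  \<open>cong_of\<close>. It gives uniqueness for \<open>C_functor\<close> and injectivity of
  \<open>adjunct\<close>.\<close>

lemma induces_cong_of_unique:
  assumes S: "S \<subseteq> alg_power A \<nu>"
    and h: "induces T P (\<nu>, cong_of T A \<nu> S) h k"
    and h': "induces T P (\<nu>, cong_of T A \<nu> S) h' k'"
    and eq: "restrict (definable_fun T A (fst P) \<nu> h) S = restrict (definable_fun T A (fst P) \<nu> h') S"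
  shows "k = k'"
proof (rule induces_arr_unique[OF h h'])
  fix p assume p: "p \<in> carrier (free_alg T (fst P))"
  have hom: "h \<in> hom T (free_alg T (fst P)) (free_alg T \<nu>)"
    "h' \<in> hom T (free_alg T (fst P)) (free_alg T \<nu>)"
    using h h' unfolding induces_def by auto
  have "ev T A \<nu> (h p) a = ev T A \<nu> (h' p) a" if "a \<in> S" for a
    using fun_cong[OF eq, of a] that S p ev_definable_fun[OF hom(1)] ev_definable_fun[OF hom(2)]
    by auto
  then have "(h p, h' p) \<in> cong_of T A \<nu> S"
    using p hom_closed[OF hom(1)] hom_closed[OF hom(2)] by (simp add: cong_of_def)
  then show "snd (\<nu>, cong_of T A \<nu> S) `` {h p} = snd (\<nu>, cong_of T A \<nu> S) `` {h' p}"
    using equiv_class_eq[OF congruence_equiv[OF congruence_cong_of[OF S]]] by simp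
qed

section \<open>The adjunction\<close>

lemma restrict_definable_fun_id:
  "S \<subseteq> alg_power A \<mu>
    \<Longrightarrow> restrict (definable_fun T A \<mu> \<mu> (\<lambda>p\<in>carrier (free_alg T \<mu>). p)) S = (\<lambda>a\<in>S. a)"
  by (auto intro!: restrict_ext definable_fun_id)

text \<open>The range condition keeps the intermediate points inside \<open>S'\<close>, where the
  second restriction has its intended value.\<close>

lemma restrict_definable_fun_compose:
  assumes "h \<in> hom T (free_alg T \<mu>) (free_alg T \<nu>)" "h' \<in> hom T (free_alg T \<nu>) (free_alg T \<rho>)"
    and "S \<subseteq> alg_power A \<rho>" "restrict (definable_fun T A \<nu> \<rho> h') S \<in> S \<rightarrow> S'"
  shows "compose S (restrict (definable_fun T A \<mu> \<nu> h) S') (restrict (definable_fun T A \<nu> \<rho> h') S)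
    = restrict (definable_fun T A \<mu> \<rho> (compose (carrier (free_alg T \<mu>)) h' h)) S"
  unfolding compose_def[of S]
proof (rule restrict_ext)
  fix a assume a: "a \<in> S"
  then have "definable_fun T A \<nu> \<rho> h' a \<in> S'" using funcset_mem[OF assms(4) a] by simp
  then show "restrict (definable_fun T A \<mu> \<nu> h) S' (restrict (definable_fun T A \<nu> \<rho> h') S a)
      = definable_fun T A \<mu> \<rho> (compose (carrier (free_alg T \<mu>)) h' h) a"
    using a assms(3) by (simp add: definable_fun_compose[OF assms(1,2)] subsetD)
qed

lemma is_category_definable_cat:
  "is_category (definable_cat T A :: (('k::wellorder, 'a) subobj, ('k, 'a) subobj_arr) cat)"
proof -
  let ?K = "definable_cat T A :: (('k, 'a) subobj, ('k, 'a) subobj_arr) cat"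
  have "Ident ?K x \<in> Arr ?K x x" if x: "x \<in> Obj ?K" for x
  proof -
    have "(\<lambda>a\<in>snd x. a)
        = restrict (definable_fun T A (fst x) (fst x) (\<lambda>p\<in>carrier (free_alg T (fst x)). p)) (snd x)"
      using x by (simp add: restrict_definable_fun_id definable_obj_iff)
    moreover have "(\<lambda>a\<in>snd x. a) \<in> snd x \<rightarrow>\<^sub>E snd x" by simp
    ultimately show ?thesis
      using hom_id[OF is_algebra_free_alg[OF wf]]
      unfolding definable_arr_iff definable_ident by blast
  qed
  moreover have "Comp ?K x y z g f \<in> Arr ?K x z"
    if x: "x \<in> Obj ?K" and f: "f \<in> Arr ?K x y" and g: "g \<in> Arr ?K y z" for x y z f g
  proof -
    obtain h h' where h: "h \<in> hom T (free_alg T (fst z)) (free_alg T (fst y))"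
        "g = restrict (definable_fun T A (fst z) (fst y) h) (snd y)"
      and h': "h' \<in> hom T (free_alg T (fst y)) (free_alg T (fst x))"
        "f = restrict (definable_fun T A (fst y) (fst x) h') (snd x)"
      using f g unfolding definable_arr_iff by blast
    have fg: "f \<in> snd x \<rightarrow>\<^sub>E snd y" "g \<in> snd y \<rightarrow>\<^sub>E snd z"
      using f g unfolding definable_arr_iff by blast+
    \<comment> \<open>Homomorphisms run against the arrows, so \<open>g\<close> after
      \<open>f\<close> comes from \<open>h'\<close> after \<open>h\<close>.\<close>
    have "compose (snd x) g f = restrict (definable_fun T A (fst z) (fst x)
        (compose (carrier (free_alg T (fst z))) h' h)) (snd x)"
      unfolding h(2) h'(2) using x fg(1)
      by (intro restrict_definable_fun_compose[OF h(1) h'(1)])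
        (auto simp: definable_obj_iff h'(2))
    moreover have "compose (snd x) g f \<in> snd x \<rightarrow>\<^sub>E snd z"
      using fg by (auto simp: compose_def)
    ultimately show ?thesis
      using hom_compose[OF h(1) h'(1) is_algebra_free_alg[OF wf]]
      unfolding definable_comp definable_arr_iff by blast
  qed
  moreover have "Comp ?K x x y f (Ident ?K x) = f" "Comp ?K x y y (Ident ?K y) f = f"
    if "f \<in> Arr ?K x y" for x y f
    using that unfolding cat_simps definable_arr_iff
    by (auto simp: compose_def fun_eq_iff PiE_iff extensional_def)
  moreover have "Comp ?K w x z h (Comp ?K w x y g f) = Comp ?K w y z (Comp ?K x y z h g) f"
    if "f \<in> Arr ?K w x" for w x y z f g h
    using that unfolding cat_simps definable_arr_iff by (auto simp: compose_def fun_eq_iff)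
  ultimately show ?thesis
    unfolding is_category_def by (simp add: definable_comp)
qed

section \<open>The arrow maps of the two functors\<close>

text \<open>Points of \<open>snd y\<close> are zeros of its own congruence, so
  \<open>induces_cong_of\<close> provides an arrow, and \<open>induces_cong_of_unique\<close> shows
  that no other \<open>h'\<close> with the same restriction gives a different one.\<close>

lemma C_functor_arr:
  assumes x: "x \<in> Obj (definable_cat T A)" and y: "y \<in> Obj (definable_cat T A)"
    and g: "restrict (definable_fun T A (fst y) (fst x) h) (snd x) \<in> snd x \<rightarrow> snd y"
    and h: "h \<in> hom T (free_alg T (fst y)) (free_alg T (fst x))"
  shows "induces T (C_obj T A y) (C_obj T A x) h
    (on_arr (C_functor T A) x y (restrict (definable_fun T A (fst y) (fst x) h) (snd x)))"
proof -
  have S: "snd x \<subseteq> alg_power A (fst x)" "snd y \<subseteq> alg_power A (fst y)"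
    using x y by (simp_all add: definable_obj_iff)
  have "\<exists>k. induces T (C_obj T A y) (C_obj T A x) h k"
    unfolding C_obj_eq[of T A x]
    using S g h subset_zeros_of_cong_of[OF S(2), of T]
    by (intro induces_cong_of) (auto simp: C_obj_eq congruence_cong_of)
  then obtain k where k: "induces T (C_obj T A y) (C_obj T A x) h k" ..
  have "on_arr (C_functor T A) x y (restrict (definable_fun T A (fst y) (fst x) h) (snd x)) = k"
    unfolding C_functor_def cat_functor.simps
  proof (rule the_equality)
    fix k' assume "\<exists>h'. induces T (C_obj T A y) (C_obj T A x) h' k' \<and>
      restrict (definable_fun T A (fst y) (fst x) h) (snd x)
        = restrict (definable_fun T A (fst y) (fst x) h') (snd x)"
    then show "k' = k"
      using induces_cong_of_unique[OF S(1), of "C_obj T A y" _ k' h k] k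
      by (auto simp: C_obj_eq)
  qed (use k in blast)
  then show ?thesis using k by simp
qed

lemma V_functor_arr:
  assumes "congruence T (free_alg T (fst Q)) (snd Q)" "induces T P Q h k"
  shows "on_arr (V_functor T A) Q P k
    = restrict (definable_fun T A (fst P) (fst Q) h) (zeros_of T A (fst Q) (snd Q))"
  using the_definable_fun[OF assms order_refl] by (simp add: V_functor_def V_obj_eq)

lemma C_obj_in:
  "x \<in> Obj (definable_cat T A) \<Longrightarrow> C_obj T A x \<in> Obj (presented_cat T)"
  by (simp add: cat_simps C_obj_eq congruence_cong_of)

lemma V_obj_in:
  "P \<in> Obj (presented_cat T) \<Longrightarrow> V_obj T A P \<in> Obj (definable_cat T A)"
  by (simp add: cat_simps V_obj_eq zeros_of_subset)

section \<open>Functoriality\<close>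

text \<open>For identities and composites, one homomorphism of free algebras is shown to induce both
  sides, and \<open>induces_arr_unique\<close> concludes.\<close>

lemma is_functor_C_functor:
  "is_functor (definable_cat T A :: (('k::wellorder, 'a) subobj, ('k, 'a) subobj_arr) cat)
    (op_cat (presented_cat T)) (C_functor T A)"
proof -
  let ?K = "definable_cat T A :: (('k, 'a) subobj, ('k, 'a) subobj_arr) cat"
    and ?L = "presented_cat T :: (('f, 'i, 'k) pres, ('f, 'i, 'k) pres_arr) cat"
    and ?C = "on_arr (C_functor T A)"
  have cong: "congruence T (free_alg T (fst (C_obj T A x))) (snd (C_obj T A x))"
    if "x \<in> Obj ?K" for x
    using C_obj_in[OF that] by (simp add: presented_obj_iff)
  have "?C x y g \<in> Arr ?L (C_obj T A y) (C_obj T A x)"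
    if xy: "x \<in> Obj ?K" "y \<in> Obj ?K" and g: "g \<in> Arr ?K x y" for x y g
  proof -
    obtain h where h: "h \<in> hom T (free_alg T (fst y)) (free_alg T (fst x))"
        "g = restrict (definable_fun T A (fst y) (fst x) h) (snd x)"
      and "g \<in> snd x \<rightarrow> snd y"
      using g unfolding definable_arr_iff PiE_def by blast
    then show ?thesis
      using C_functor_arr[OF xy, of h] unfolding presented_arr induces_def by simp
  qed
  moreover have "?C x x (Ident ?K x) = Ident ?L (C_obj T A x)" if x: "x \<in> Obj ?K" for x
  proof -
    let ?i = "\<lambda>p\<in>carrier (free_alg T (fst x)). p"
    have i: "restrict (definable_fun T A (fst x) (fst x) ?i) (snd x) = (\<lambda>a\<in>snd x. a)"
      using x by (simp add: restrict_definable_fun_id definable_obj_iff)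
    then have "induces T (C_obj T A x) (C_obj T A x) ?i (?C x x (Ident ?K x))"
      using C_functor_arr[OF x x, of ?i] hom_id[OF is_algebra_free_alg[OF wf], of "fst x"]
      by (simp add: definable_ident)
    moreover have "induces T (C_obj T A x) (C_obj T A x) ?i (Ident ?L (C_obj T A x))"
      using induces_id[OF wf cong[OF x]] by (simp add: presented_ident C_obj_eq)
    ultimately show ?thesis by (rule induces_arr_unique) simp
  qed
  moreover have "?C x z (Comp ?K x y z g f)
      = Comp ?L (C_obj T A z) (C_obj T A y) (C_obj T A x) (?C x y f) (?C y z g)"
    if xyz: "x \<in> Obj ?K" "y \<in> Obj ?K" "z \<in> Obj ?K"
      and f: "f \<in> Arr ?K x y" and g: "g \<in> Arr ?K y z" for x y z f g
  proof -
    obtain h h' where h: "h \<in> hom T (free_alg T (fst z)) (free_alg T (fst y))"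
        "g = restrict (definable_fun T A (fst z) (fst y) h) (snd y)"
      and h': "h' \<in> hom T (free_alg T (fst y)) (free_alg T (fst x))"
        "f = restrict (definable_fun T A (fst y) (fst x) h') (snd x)"
      using f g unfolding definable_arr_iff by blast
    have fg: "f \<in> snd x \<rightarrow> snd y" "g \<in> snd y \<rightarrow> snd z"
      using f g unfolding definable_arr_iff by auto
    let ?h = "compose (carrier (free_alg T (fst z))) h' h"
    have gf: "compose (snd x) g f = restrict (definable_fun T A (fst z) (fst x) ?h) (snd x)"
      unfolding h(2) h'(2) using xyz(1) fg(1)
      by (intro restrict_definable_fun_compose[OF h(1) h'(1)])
        (simp_all add: definable_obj_iff h'(2))
    have "compose (snd x) g f \<in> snd x \<rightarrow> snd z" using fg by (auto simp: compose_def)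
    then have "induces T (C_obj T A z) (C_obj T A x) ?h (?C x z (compose (snd x) g f))"
      unfolding gf
      using C_functor_arr[OF xyz(1,3)] hom_compose[OF h(1) h'(1) is_algebra_free_alg[OF wf]]
      by blast
    moreover have "induces T (C_obj T A z) (C_obj T A x) ?h
        (compose (carrier (pres_alg T (C_obj T A z))) (?C x y f) (?C y z g))"
      using induces_compose[OF wf cong[OF xyz(3)]
          C_functor_arr[OF xyz(2,3) fg(2)[unfolded h(2)] h(1), folded h(2)]
          C_functor_arr[OF xyz(1,2) fg(1)[unfolded h'(2)] h'(1), folded h'(2)]]
      by (simp add: C_obj_eq)
    ultimately show ?thesis
      unfolding definable_comp presented_comp by (rule induces_arr_unique) simp
  qed
  moreover have "C_obj T A x \<in> Obj ?L" if "x \<in> Obj ?K" for x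
    using that by (rule C_obj_in)
  ultimately show ?thesis
    unfolding is_functor_def op_cat_def by (simp add: on_obj_C_functor)
qed

text \<open>Arrows are lifted to free algebras by \<open>induces_ex_free\<close>; the laws then
  become those of \<open>definable_fun\<close>, restricted to zero sets.\<close>

lemma is_functor_V_functor:
  "is_functor (op_cat (presented_cat T))
    (definable_cat T A :: (('k::wellorder, 'a) subobj, ('k, 'a) subobj_arr) cat) (V_functor T A)"
proof -
  let ?K = "definable_cat T A :: (('k, 'a) subobj, ('k, 'a) subobj_arr) cat"
    and ?L = "presented_cat T :: (('f, 'i, 'k) pres, ('f, 'i, 'k) pres_arr) cat"
    and ?V = "on_arr (V_functor T A)"
  have cong: "congruence T (free_alg T (fst P)) (snd P)" if "P \<in> Obj ?L" for P
    using that by (simp add: presented_obj_iff)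
  have "?V Q P k \<in> Arr ?K (V_obj T A Q) (V_obj T A P)"
    if PQ: "P \<in> Obj ?L" "Q \<in> Obj ?L" and k: "k \<in> Arr ?L P Q" for P Q k
  proof -
    obtain h where h: "induces T P Q h k"
      using induces_ex_free[OF wf cong[OF PQ(1)] cong[OF PQ(2)]] k unfolding presented_arr by blast
    show ?thesis
      using definable_fun_zeros[OF cong[OF PQ(1)] cong[OF PQ(2)] h] h
      unfolding V_functor_arr[OF cong[OF PQ(2)] h] definable_arr_iff V_obj_eq induces_def by auto
  qed
  moreover have "?V P P (Ident ?L P) = Ident ?K (V_obj T A P)" if P: "P \<in> Obj ?L" for P
    using V_functor_arr[OF cong[OF P] induces_id[OF wf cong[OF P]]]
    by (simp add: presented_ident definable_ident V_obj_eq restrict_definable_fun_id zeros_of_subset)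
  moreover have "?V R P (Comp ?L P Q R l k)
      = Comp ?K (V_obj T A R) (V_obj T A Q) (V_obj T A P) (?V Q P k) (?V R Q l)"
    if PQR: "P \<in> Obj ?L" "Q \<in> Obj ?L" "R \<in> Obj ?L"
      and k: "k \<in> Arr ?L P Q" and l: "l \<in> Arr ?L Q R" for P Q R k l
  proof -
    obtain h h' where h: "induces T P Q h k" and h': "induces T Q R h' l"
      using induces_ex_free[OF wf cong[OF PQR(1)] cong[OF PQR(2)]]
        induces_ex_free[OF wf cong[OF PQR(2)] cong[OF PQR(3)]] k l unfolding presented_arr by blast
    then have hom: "h \<in> hom T (free_alg T (fst P)) (free_alg T (fst Q))"
      "h' \<in> hom T (free_alg T (fst Q)) (free_alg T (fst R))"
      unfolding induces_def by blast+
    show ?thesis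
      unfolding presented_comp definable_comp V_obj_eq fst_conv snd_conv
        V_functor_arr[OF cong[OF PQR(2)] h] V_functor_arr[OF cong[OF PQR(3)] h']
        V_functor_arr[OF cong[OF PQR(3)] induces_compose[OF wf cong[OF PQR(1)] h h']]
      \<comment> \<open>The intermediate points are zeros of \<open>snd Q\<close>, as composing the
        restrictions requires.\<close>
      using definable_fun_zeros[OF cong[OF PQR(2)] cong[OF PQR(3)] h']
      by (intro restrict_definable_fun_compose[symmetric] hom zeros_of_subset) auto
  qed
  moreover have "V_obj T A P \<in> Obj ?K" if "P \<in> Obj ?L" for P
    using that by (rule V_obj_in)
  ultimately show ?thesis
    unfolding is_functor_def op_cat_def by (simp add: on_obj_V_functor)
qed

section \<open>The bijection of hom-sets\<close>

text \<open>This is the value of \<open>V_functor\<close> at \<open>k\<close>, precomposed with the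
  inclusion of \<open>snd x\<close> into the zeros of its own congruence, which is the unit of the
  adjunction.\<close>

definition adjunct ::
  "('k::wellorder, 'a) subobj \<Rightarrow> ('f, 'i, 'k) pres \<Rightarrow> ('f, 'i, 'k) pres_arr \<Rightarrow> ('k, 'a) subobj_arr"
  where
  "adjunct x P k = (THE g. \<exists>h. induces T P (C_obj T A x) h k \<and>
    g = restrict (definable_fun T A (fst P) (fst x) h) (snd x))"

lemma adjunct_eq:
  assumes x: "x \<in> Obj (definable_cat T A)" and h: "induces T P (C_obj T A x) h k"
  shows "adjunct x P k = restrict (definable_fun T A (fst P) (fst x) h) (snd x)"
proof -
  have "snd x \<subseteq> alg_power A (fst x)" using x by (simp add: definable_obj_iff)
  from congruence_cong_of[OF this] subset_zeros_of_cong_of[OF this, of T] show ?thesis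
    using the_definable_fun[of "C_obj T A x" P h k "snd x"] h
    by (simp add: adjunct_def C_obj_eq)
qed

lemma bij_betw_adjunct:
  assumes x: "x \<in> Obj (definable_cat T A)" and P: "P \<in> Obj (presented_cat T)"
  shows "bij_betw (adjunct x P) (Arr (presented_cat T) P (C_obj T A x))
    (Arr (definable_cat T A) x (V_obj T A P))"
proof -
  have S: "snd x \<subseteq> alg_power A (fst x)" using x by (simp add: definable_obj_iff)
  have cong: "congruence T (free_alg T (fst P)) (snd P)"
    "congruence T (free_alg T (fst (C_obj T A x))) (snd (C_obj T A x))"
    using P C_obj_in[OF x] by (simp_all add: presented_obj_iff)
  note ex = induces_ex_free[OF wf cong, folded presented_arr]
  show ?thesis
  proof (rule bij_betw_imageI)
    show "inj_on (adjunct x P) (Arr (presented_cat T) P (C_obj T A x))"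
    proof (rule inj_onI)
      fix k k' assume k: "k \<in> Arr (presented_cat T) P (C_obj T A x)"
        and k': "k' \<in> Arr (presented_cat T) P (C_obj T A x)"
        and eq: "adjunct x P k = adjunct x P k'"
      obtain h where h: "induces T P (C_obj T A x) h k" using ex[OF k] ..
      obtain h' where h': "induces T P (C_obj T A x) h' k'" using ex[OF k'] ..
      show "k = k'"
        using induces_cong_of_unique[OF S h[unfolded C_obj_eq] h'[unfolded C_obj_eq]] eq
        unfolding adjunct_eq[OF x h] adjunct_eq[OF x h'] .
    qed
    show "adjunct x P ` Arr (presented_cat T) P (C_obj T A x) = Arr (definable_cat T A) x (V_obj T A P)"
    proof (intro equalityI subsetI)
      fix g assume "g \<in> adjunct x P ` Arr (presented_cat T) P (C_obj T A x)"
      then obtain k where k: "k \<in> Arr (presented_cat T) P (C_obj T A x)" "g = adjunct x P k"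
        by blast
      obtain h where h: "induces T P (C_obj T A x) h k" using ex[OF k(1)] ..
      have "definable_fun T A (fst P) (fst x) h a \<in> zeros_of T A (fst P) (snd P)" if "a \<in> snd x" for a
        using definable_fun_zeros[OF cong h, of a] subset_zeros_of_cong_of[OF S, of T] that
        by (auto simp: C_obj_eq)
      then show "g \<in> Arr (definable_cat T A) x (V_obj T A P)"
        using h unfolding k(2) adjunct_eq[OF x h] definable_arr_iff induces_def V_obj_eq C_obj_eq
        by auto
    next
      fix g assume "g \<in> Arr (definable_cat T A) x (V_obj T A P)"
      then obtain h where h: "h \<in> hom T (free_alg T (fst P)) (free_alg T (fst x))"
        and g: "g = restrict (definable_fun T A (fst P) (fst x) h) (snd x)"
          "g \<in> snd x \<rightarrow>\<^sub>E zeros_of T A (fst P) (snd P)"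
        unfolding definable_arr_iff V_obj_eq by auto
      \<comment> \<open>That \<open>g\<close> takes values in the zeros of \<open>snd P\<close> is
        precisely what lets \<open>h\<close> descend to the quotients.\<close>
      have "\<exists>k. induces T P (C_obj T A x) h k"
        unfolding C_obj_eq using g by (intro induces_cong_of[OF cong(1) S h]) auto
      then obtain k where k: "induces T P (C_obj T A x) h k" ..
      then have "k \<in> Arr (presented_cat T) P (C_obj T A x)"
        unfolding presented_arr induces_def by blast
      moreover have "g = adjunct x P k" using adjunct_eq[OF x k] g(1) by simp
      ultimately show "g \<in> adjunct x P ` Arr (presented_cat T) P (C_obj T A x)" by blast
    qed
  qed
qed

section \<open>Naturality and conclusion\<close>

text \<open>With \<open>hg\<close>, \<open>hu\<close>, \<open>hf\<close> inducing \<open>g\<close>,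
  \<open>u\<close> and the image of \<open>f\<close> under \<open>C_functor\<close>, both sides are
  the restriction of the definable function of the composite of \<open>hg\<close>, then
  \<open>hu\<close>, then \<open>hf\<close>.\<close>

lemma adjunct_natural:
  assumes x: "x \<in> Obj (definable_cat T A)" and x': "x' \<in> Obj (definable_cat T A)"
    and P: "P \<in> Obj (presented_cat T)" and P': "P' \<in> Obj (presented_cat T)"
    and f: "f \<in> Arr (definable_cat T A) x' x" and g: "g \<in> Arr (presented_cat T) P' P"
    and u: "u \<in> Arr (presented_cat T) P (C_obj T A x)"
  shows "adjunct x' P' (compose (carrier (pres_alg T P'))
      (compose (carrier (pres_alg T P)) (on_arr (C_functor T A) x' x f) u) g)
    = compose (snd x') (on_arr (V_functor T A) P P' g) (compose (snd x') (adjunct x P u) f)"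
proof -
  have S: "snd x' \<subseteq> alg_power A (fst x')" using x' by (simp add: definable_obj_iff)
  have cong: "congruence T (free_alg T (fst P)) (snd P)"
    "congruence T (free_alg T (fst P')) (snd P')"
    "congruence T (free_alg T (fst (C_obj T A x))) (snd (C_obj T A x))"
    "congruence T (free_alg T (fst (C_obj T A x'))) (snd (C_obj T A x'))"
    using P P' C_obj_in[OF x] C_obj_in[OF x'] by (simp_all add: presented_obj_iff)
  obtain hf where hf: "hf \<in> hom T (free_alg T (fst x)) (free_alg T (fst x'))"
    and f_eq: "f = restrict (definable_fun T A (fst x) (fst x') hf) (snd x')"
    and f_maps: "f \<in> snd x' \<rightarrow> snd x"
    using f unfolding definable_arr_iff PiE_def by blast
  obtain hg where hg: "induces T P' P hg g"
    using induces_ex_free[OF wf cong(2,1)] g unfolding presented_arr by blast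
  obtain hu where hu: "induces T P (C_obj T A x) hu u"
    using induces_ex_free[OF wf cong(1,3)] u unfolding presented_arr by blast
  have hom: "hg \<in> hom T (free_alg T (fst P')) (free_alg T (fst P))"
    "hu \<in> hom T (free_alg T (fst P)) (free_alg T (fst x))"
    using hg hu unfolding induces_def C_obj_eq by simp_all
  let ?h = "compose (carrier (free_alg T (fst P))) hf hu"
  have "induces T (C_obj T A x) (C_obj T A x') hf (on_arr (C_functor T A) x' x f)"
    unfolding f_eq using C_functor_arr[OF x' x f_maps[unfolded f_eq] hf] .
  note h = induces_compose[OF wf cong(1) hu this]
  \<comment> \<open>This range condition is needed to compose with the value of
    \<open>V_functor\<close> at \<open>g\<close>, which is restricted to the zeros of
    \<open>snd P\<close>.\<close>
  have "definable_fun T A (fst P) (fst x') ?h a \<in> zeros_of T A (fst P) (snd P)" if "a \<in> snd x'" for a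
    using definable_fun_zeros[OF cong(1,4) h, of a] subset_zeros_of_cong_of[OF S, of T] that
    by (auto simp: C_obj_eq)
  then have maps: "restrict (definable_fun T A (fst P) (fst x') ?h) (snd x')
      \<in> snd x' \<rightarrow> zeros_of T A (fst P) (snd P)" by auto
  have "compose (snd x') (adjunct x P u) f
      = restrict (definable_fun T A (fst P) (fst x') ?h) (snd x')"
    unfolding adjunct_eq[OF x hu] f_eq
    by (rule restrict_definable_fun_compose[OF hom(2) hf S f_maps[unfolded f_eq]])
  then show ?thesis
    unfolding adjunct_eq[OF x' induces_compose[OF wf cong(2) hg h]] V_functor_arr[OF cong(1) hg]
    using restrict_definable_fun_compose[OF hom(1) hom_compose[OF hom(2) hf is_algebra_free_alg[OF wf]]
        S maps]
    by simp
qed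

end

theorem corollary4p8:
  fixes T :: "('f, 'i, 'v) eq_theory" and A :: "('f, 'i, 'a) algebra"
  assumes "wf_theory T" and "in_variety T A"
  shows "adjunction
    (definable_cat T A :: (('k::wellorder, 'a) subobj, ('k, 'a) subobj_arr) cat)
    (op_cat (presented_cat T))
    (C_functor T A)
    (V_functor T A)"
  unfolding adjunction_def
proof (intro conjI exI[of _ "adjunct T A"])
  show "is_category (definable_cat T A :: (('k, 'a) subobj, ('k, 'a) subobj_arr) cat)"
    by (rule is_category_definable_cat[OF assms])
  show "is_category (op_cat (presented_cat T :: (('f, 'i, 'k) pres, ('f, 'i, 'k) pres_arr) cat))"
    by (rule is_category_op_cat[OF is_category_presented_cat[OF assms(1)]])
  show "is_functor (definable_cat T A :: (('k, 'a) subobj, ('k, 'a) subobj_arr) cat)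
      (op_cat (presented_cat T)) (C_functor T A)"
    by (rule is_functor_C_functor[OF assms])
  show "is_functor (op_cat (presented_cat T))
      (definable_cat T A :: (('k, 'a) subobj, ('k, 'a) subobj_arr) cat) (V_functor T A)"
    by (rule is_functor_V_functor[OF assms])
\<comment> \<open>Unfolding \<open>op_cat\<close> turns an arrow from the image of \<open>x\<close>
  to \<open>P\<close> into a homomorphism from \<open>P\<close> to that image and reverses
  composites, which is the form of \<open>bij_betw_adjunct\<close> and
  \<open>adjunct_natural\<close>.\<close>
qed (simp_all add: op_cat_def on_obj_C_functor on_obj_V_functor definable_comp
    presented_comp bij_betw_adjunct[OF assms] adjunct_natural[OF assms])

end
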